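(* Let $n\ge2$, $1<\mathscr{P}\le n-1$, $N=\binom{n}{\mathscr{P}}$, let $0\le l<k\le N$ be integers, $q=k+1$, and $p$ a constant with $p>q-l$. Let $\varphi\in C^2(\mathbb{S}^n)$ be positive and let $u\in C^4(\mathbb{S}^n)$ be a positive admissible solution of $$\frac{\sigma_k(\Lambda(\nabla^2u+uI))}{\sigma_l(\Lambda(\nabla^2u+uI))}=u^{p-1}\varphi\quad\text{on }\mathbb{S}^n.$$ Then there exists a positive constant $C$, depending only on $n,k,l,p$, $\min_{\mathbb{S}^n}\varphi$, $\|u\|_{C^1}$ and $\|\varphi\|_{C^2}$, such that $|\nabla^2u(x)|\le C$ for all $x\in\mathbb{S}^n$.
   Context: $\mathbb{S}^n$ is the unit sphere with its standard metric; $\nabla^2u$ is the covariant Hessian in a local orthonormal frame; $I$ is the identity. Let $\mathbf{I}_1,\dots,\mathbf{I}_N$ enumerate the multi-indices $1\le i_1<\dots<i_{\mathscr{P}}\le n$. For a symmetric matrix $A$ with eigenvalues $\lambda$, $\Lambda(A)=(\Lambda_{\mathbf{I}_1},\dots,\Lambda_{\mathbf{I}_N})$ with $\Lambda_{\mathbf{I}}=\lambda_{i_1}+\dots+\lambda_{i_{\mathscr{P}}}$. $\sigma_m$ is the $m$-th elementary symmetric polynomial, $\sigma_0=1$; $\Gamma_k=\{\mu\in\mathbb{R}^N:\sigma_j(\mu)>0,\ 1\le j\le k\}$. A function $u\in C^2(\mathbb{S}^n)$ is admissible if $\Lambda(\nabla^2u+uI)\in\Gamma_k$ at every point. *)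

theory Defs
  imports "HOL-Analysis.Analysis"
begin

text \<open>Functions on the unit sphere S^n of 'a (with DIM('a) = n+1) are given as functions
 'a => real, of which only the values on sphere 0 1 matter.  They are extended
 0-homogeneously to the open set -{0}.\<close>

definition ext0 :: "('a::euclidean_space \<Rightarrow> real) \<Rightarrow> 'a \<Rightarrow> real" where
  "ext0 u y = u (y /\<^sub>R norm y)"

fun Ck :: "nat \<Rightarrow> 'a::euclidean_space set \<Rightarrow> ('a \<Rightarrow> real) \<Rightarrow> bool" where
  "Ck 0 S f = continuous_on S f"
| "Ck (Suc k) S f = (continuous_on S f \<and> f differentiable_on S \<and>
      (\<forall>v\<in>Basis. Ck k S (\<lambda>x. frechet_derivative f (at x) v)))"

definition D1 :: "('a::euclidean_space \<Rightarrow> real) \<Rightarrow> 'a \<Rightarrow> 'a \<Rightarrow> real" where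
  "D1 f x v = frechet_derivative f (at x) v"

definition D2 :: "('a::euclidean_space \<Rightarrow> real) \<Rightarrow> 'a \<Rightarrow> 'a \<Rightarrow> 'a \<Rightarrow> real" where
  "D2 f x v w = frechet_derivative (\<lambda>y. D1 f y w) (at x) v"

definition Ck_sphere :: "nat \<Rightarrow> ('a::euclidean_space \<Rightarrow> real) \<Rightarrow> bool" where
  "Ck_sphere k u = Ck k (- {0}) (ext0 u)"

definition sgrad :: "('a::euclidean_space \<Rightarrow> real) \<Rightarrow> 'a \<Rightarrow> 'a \<Rightarrow> real" where
  "sgrad u x X = D1 (ext0 u) x X"

text \<open>Covariant Hessian of u on the unit sphere at x, evaluated on tangent vectors X, Y
  (Gauss formula: ambient Hessian of an extension minus the normal derivative times X.Y).\<close>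
definition shess :: "('a::euclidean_space \<Rightarrow> real) \<Rightarrow> 'a \<Rightarrow> 'a \<Rightarrow> 'a \<Rightarrow> real" where
  "shess u x X Y = D2 (ext0 u) x X Y - D1 (ext0 u) x x * (X \<bullet> Y)"

definition diag_frame :: "nat \<Rightarrow> 'a::euclidean_space \<Rightarrow> ('a \<Rightarrow> 'a \<Rightarrow> real) \<Rightarrow> (nat \<Rightarrow> 'a)
     \<Rightarrow> (nat \<Rightarrow> real) \<Rightarrow> bool" where
  "diag_frame n x h e lam \<longleftrightarrow>
     (\<forall>i<n. e i \<bullet> x = 0) \<and>
     (\<forall>i<n. \<forall>j<n. e i \<bullet> e j = (if i = j then 1 else 0)) \<and>
     (\<forall>i<n. \<forall>j<n. h (e i) (e j) = (if i = j then lam i else 0))"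

text \<open>Multi-indices 1 <= i_1 < ... < i_P <= n, represented as P-subsets of {0..<n}.\<close>
definition multi_idx :: "nat \<Rightarrow> nat \<Rightarrow> nat set set" where
  "multi_idx n P = {I. I \<subseteq> {0..<n} \<and> card I = P}"

definition Lam :: "(nat \<Rightarrow> real) \<Rightarrow> nat set \<Rightarrow> real" where
  "Lam lam I = (\<Sum>i\<in>I. lam i)"

definition sigma :: "nat \<Rightarrow> 'b set \<Rightarrow> ('b \<Rightarrow> real) \<Rightarrow> real" where
  "sigma m A mu = (\<Sum>T\<in>{T. T \<subseteq> A \<and> card T = m}. \<Prod>a\<in>T. mu a)"

definition in_Gamma :: "nat \<Rightarrow> 'b set \<Rightarrow> ('b \<Rightarrow> real) \<Rightarrow> bool" where
  "in_Gamma k A mu \<longleftrightarrow> (\<forall>j. 1 \<le> j \<and> j \<le> k \<longrightarrow> sigma j A mu > 0)"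

end

theory Submission
  imports Defs "HOL-Computational_Algebra.Fundamental_Theorem_Algebra" "HOL-Combinatorics.Permutations"
begin

text \<open>
  Extend u to the 1-homogeneous function U(y) = |y| u(y/|y|). Its Euclidean Hessian annihilates y
  and restricts to the Hessian of u plus u I on tangent vectors, so the estimate becomes a maximum
  principle in flat space with commuting derivatives. Let M be the largest eigenvalue over the
  whole sphere, attained at x in the direction e. Maximality bounds the pure fourth derivatives of
  U at x from above, and it follows that the diagonal entries of the Hessian along x + t e, in a
  frame rotating with the point, have nonpositive second derivative at t = 0.

  The quotients of consecutive elementary symmetric polynomials are superadditive on the Garding
  cone, hence lie below their supergradients, which have nonnegative coefficients; by symmetry the
  supergradient bound also holds for the diagonal entries of a non-diagonal matrix. Since the
  equation prescribes a product of such quotients, log (u^(p-1) phi) has nonpositive second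
  derivative at x in the direction e. The term (p-1) M / u in it is then controlled by the
  remaining ones. A positive lower bound for u comes from the equation at a minimum of u, because
  p - 1 > k - l. Finally the trace is positive, so an upper bound for the eigenvalues bounds them
  from below as well.
\<close>

section \<open>Newton inequality and superadditivity of quotients\<close>

text \<open>Eigenvalues need not be differentiable where they collide, so none is ever
  differentiated. Along \<open>x + t *\<^sub>R e i0\<close> the logarithm of the right-hand side is
  compared with logarithms of linear forms whose coefficients are frozen at \<open>t = 0\<close>. It
  lies below their sum and touches it at \<open>t = 0\<close>; only this smooth difference is
  differentiated twice. A product of quotients of degree one, rather than a root of
  \<open>sigma k / sigma l\<close>, suits this: superadditivity and homogeneity alone supply the
  supergradients, and the logarithm turns the product into a sum. In flat space fourth derivatives
  commute without curvature terms, so in a direction other than the maximal one the exchange leaves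
  only \<open>lam i - M\<close>, which has the favourable sign. The hypothesis on \<open>p\<close>
  amounts to \<open>p - 1 > k - l \<ge> 1\<close>: it gives the lower bound for \<open>u\<close> and
  also the positive factor \<open>p - 1\<close> in front of \<open>M / u\<close>.\<close>

definition real_split :: "complex poly \<Rightarrow> bool" where
  "real_split P \<longleftrightarrow> (\<exists>c M. P = smult (of_real c) (\<Prod>a\<in>#M. [:- of_real a, 1:]))"

text \<open>For real \<open>a\<close> the imaginary part of \<open>1 / (z - a)\<close> has the sign
  opposite to \<open>Im z\<close>. The factor \<open>Im z\<close> makes this a single inequality for
  both half planes, which adds up over the roots.\<close>

lemma logderiv_real_split:
  fixes M :: "real multiset" and z :: complex
  defines "Q \<equiv> \<lambda>M. (\<Prod>a\<in>#M. [:- of_real a, 1:]) :: complex poly"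
  assumes "Im z \<noteq> 0"
  shows "poly (Q M) z \<noteq> 0"
    and "M \<noteq> {#} \<Longrightarrow> Im z * Im (poly (pderiv (Q M)) z / poly (Q M) z) < 0"
proof -
  have nz: "z - of_real a \<noteq> 0" for a
    using assms(2) by (auto simp: complex_eq_iff)
  have 1: "poly (Q M) z \<noteq> 0" for M
    using nz by (induction M) (auto simp: Q_def)
  then show "poly (Q M) z \<noteq> 0" .
  have neg: "Im z * Im (1 / (z - of_real a)) < 0" for a
  proof -
    have "Im z * Im (1 / (z - of_real a)) = - ((Im z)\<^sup>2 / (cmod (z - of_real a))\<^sup>2)"
      by (simp add: Im_divide power2_eq_square cmod_def)
    also have "\<dots> < 0"
      using assms(2) nz[of a] by simp
    finally show ?thesis .
  qed
  have step: "poly (pderiv (Q (add_mset a M))) z / poly (Q (add_mset a M)) z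
      = 1 / (z - of_real a) + poly (pderiv (Q M)) z / poly (Q M) z" for a M
  proof -
    have "Q (add_mset a M) = [:- of_real a, 1:] * Q M"
      by (simp add: Q_def)
    then have "poly (pderiv (Q (add_mset a M))) z = (z - of_real a) * poly (pderiv (Q M)) z + poly (Q M) z"
      and "poly (Q (add_mset a M)) z = (z - of_real a) * poly (Q M) z"
      by (simp_all add: pderiv_mult pderiv_pCons del: mult_pCons_left)
    then show ?thesis
      using nz[of a] 1[of M] by (simp add: add_divide_distrib)
  qed
  show "M \<noteq> {#} \<Longrightarrow> Im z * Im (poly (pderiv (Q M)) z / poly (Q M) z) < 0"
  proof (induction M)
    case (add a M)
    show ?case
    proof (cases "M = {#}")
      case True
      then show ?thesis unfolding step using neg[of a] by (simp add: Q_def)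
    next
      case False
      then show ?thesis unfolding step using neg[of a] add
        by (simp add: distrib_left)
    qed
  qed simp
qed

text \<open>Gauss--Lucas: off the real axis the imaginary parts of all the terms of the logarithmic
  derivative have the same sign, so the derivative has no zeros there.\<close>

lemma real_split_pderiv:
  assumes "real_split P"
  shows "real_split (pderiv P)"
proof -
  obtain c M where P: "P = smult (of_real c) (\<Prod>a\<in>#M. [:- of_real a, 1:])"
    using assms unfolding real_split_def by blast
  define Q where "Q = (\<Prod>a\<in>#M. [:- of_real a, 1:] :: complex poly)"
  have PQ: "pderiv P = smult (of_real c) (pderiv Q)"
    using P by (simp add: Q_def pderiv_smult)
  show ?thesis
  proof (cases "M = {#}")
    case True
    then show ?thesis
      unfolding PQ real_split_def Q_def by (intro exI[of _ 0]) (simp add: pderiv_smult)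
  next
    case False
    have real: "Im z = 0" if "poly (pderiv Q) z = 0" for z
      using logderiv_real_split(2)[of z M] False that by (auto simp: Q_def)
    have monic: "lead_coeff Q = 1"
    proof -
      have "lead_coeff (\<Prod>a\<in>#M. [:- of_real a, 1:] :: complex poly) = 1"
        by (induction M) (auto simp: lead_coeff_mult simp del: mult_pCons_left)
      then show ?thesis by (simp add: Q_def)
    qed
    have lc: "lead_coeff (pderiv Q) = of_real (real (degree Q))"
    proof -
      have "degree (\<Prod>a\<in>#M. [:- of_real a, 1:] :: complex poly) = size M"
      proof (induction M)
        case (add a M)
        have "(\<Prod>a\<in>#M. [:- of_real a, 1:] :: complex poly) \<noteq> 0"
          by (auto simp: prod_mset_zero_iff)
        then show ?case using add by (simp add: degree_mult_eq del: mult_pCons_left)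
      qed simp
      then have "degree Q > 0" using False by (simp add: Q_def nonempty_has_size)
      then show ?thesis using monic by (simp add: coeff_pderiv degree_pderiv)
    qed
    have nz: "pderiv Q \<noteq> 0"
    proof
      \<comment> \<open>The zero polynomial would have the imaginary unit among its roots, but all
        roots are real.\<close>
      assume "pderiv Q = 0"
      then have "Im \<i> = 0" by (intro real) simp
      then show False by simp
    qed
    have "pderiv Q = smult (of_real (real (degree Q))) (\<Prod>x\<in>#proots (pderiv Q). [:-x, 1:])"
      using complex_poly_decompose_multiset[of "pderiv Q"] lc by simp
    also have "proots (pderiv Q) = image_mset of_real (image_mset Re (proots (pderiv Q)))"
      using nz real by (auto simp: multiset.map_comp o_def complex_eq_iff intro!: multiset.map_ident_strong[symmetric])
    finally have "pderiv Q = smult (of_real (real (degree Q)))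
        (\<Prod>a\<in>#image_mset Re (proots (pderiv Q)). [:- of_real a, 1:])"
      by (simp only: multiset.map_comp o_def)
    then show ?thesis
      unfolding PQ real_split_def by (metis smult_smult of_real_mult)
  qed
qed

text \<open>Induction on the linear factors. Multiplying by \<open>X - a\<close> turns the values
  \<open>q0, q1, q2\<close> at 0 into \<open>- a * q0\<close>, \<open>q0 - a * q1\<close>,
  \<open>2 * q1 - a * q2\<close>, and the new gap is \<open>q0\<^sup>2\<close> plus
  \<open>a\<^sup>2\<close> times the old one. No division by the polynomial occurs, so 0 may be a
  root.\<close>

lemma laguerre_real_split:
  fixes c0 c1 c2 :: real
  assumes "real_split P"
    and "poly P 0 = of_real c0" "poly (pderiv P) 0 = of_real c1" "poly (pderiv (pderiv P)) 0 = of_real c2"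
  shows "c0 * c2 \<le> c1\<^sup>2"
proof -
  obtain c M where P: "P = smult (of_real c) (\<Prod>a\<in>#M. [:- of_real a, 1:])"
    using assms unfolding real_split_def by blast
  have "\<exists>q0 q1 q2. q0 * q2 \<le> q1\<^sup>2 \<and> poly (\<Prod>a\<in>#M. [:- complex_of_real a, 1:]) 0 = of_real q0 \<and>
      poly (pderiv (\<Prod>a\<in>#M. [:- complex_of_real a, 1:])) 0 = of_real q1 \<and>
      poly (pderiv (pderiv (\<Prod>a\<in>#M. [:- complex_of_real a, 1:]))) 0 = of_real q2"
  proof (induction M)
    case empty
    show ?case by (intro exI[of _ 1] exI[of _ 0]) simp
  next
    case (add a M)
    then obtain q0 q1 q2 where q: "q0 * q2 \<le> q1\<^sup>2" 
      "poly (\<Prod>a\<in>#M. [:- complex_of_real a, 1:]) 0 = of_real q0"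
      "poly (pderiv (\<Prod>a\<in>#M. [:- complex_of_real a, 1:])) 0 = of_real q1"
      "poly (pderiv (pderiv (\<Prod>a\<in>#M. [:- complex_of_real a, 1:]))) 0 = of_real q2"
      by blast
    have ineq: "(- a * q0) * (2 * q1 - a * q2) \<le> (q0 - a * q1)\<^sup>2"
    proof -
      have "(q0 - a * q1)\<^sup>2 - (- a * q0) * (2 * q1 - a * q2) = q0\<^sup>2 + a\<^sup>2 * (q1\<^sup>2 - q0 * q2)"
        by (simp add: power2_eq_square algebra_simps)
      also have "\<dots> \<ge> 0" using q(1) by simp
      finally show ?thesis by simp
    qed
    show ?case
      by (rule exI[of _ "- a * q0"], rule exI[of _ "q0 - a * q1"], rule exI[of _ "2 * q1 - a * q2"])
        (use ineq q in \<open>simp add: pderiv_mult pderiv_pCons pderiv_add pderiv_minus pderiv_smult del: mult_pCons_left\<close>)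
  qed
  then obtain q0 q1 q2 where q: "q0 * q2 \<le> q1\<^sup>2"
    "poly P 0 = of_real (c * q0)" "poly (pderiv P) 0 = of_real (c * q1)"
    "poly (pderiv (pderiv P)) 0 = of_real (c * q2)"
    unfolding P by (auto simp: pderiv_smult)
  then have "c0 = c * q0" "c1 = c * q1" "c2 = c * q2"
    using assms of_real_eq_iff by metis+
  then show ?thesis
    using mult_left_mono[OF q(1), of "c\<^sup>2"] by (simp add: power2_eq_square algebra_simps)
qed

section \<open>Elementary symmetric polynomials and the Garding cone\<close>

lemma sigma_0 [simp]: "finite A \<Longrightarrow> sigma 0 A x = 1"
proof -
  assume "finite A"
  then have "{T. T \<subseteq> A \<and> card T = 0} = {{}}"
    by (auto dest: finite_subset)
  then show ?thesis by (simp add: sigma_def)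
qed

lemma sigma_gt_card: "finite A \<Longrightarrow> card A < m \<Longrightarrow> sigma m A x = 0"
  unfolding sigma_def by (rule sum.neutral) (auto dest: card_mono)

lemma sigma_Suc_insert:
  assumes "finite A" "a \<notin> A"
  shows "sigma (Suc m) (insert a A) x = x a * sigma m A x + sigma (Suc m) A x"
proof -
  let ?S = "\<lambda>m A. {T. T \<subseteq> A \<and> card T = m}"
  have fin: "finite (?S m A)" for m using assms(1) by simp
  have fT: "finite T" if "T \<subseteq> A" for T using that assms(1) finite_subset by blast
  have split: "?S (Suc m) (insert a A) = insert a ` ?S m A \<union> ?S (Suc m) A"
  proof (intro equalityI subsetI)
    fix T assume T: "T \<in> ?S (Suc m) (insert a A)"
    show "T \<in> insert a ` ?S m A \<union> ?S (Suc m) A"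
    proof (cases "a \<in> T")
      case True
      then have "T = insert a (T - {a})" "T - {a} \<in> ?S m A" using T by auto
      then show ?thesis by blast
    qed (use T in auto)
  next
    fix T assume "T \<in> insert a ` ?S m A \<union> ?S (Suc m) A"
    then show "T \<in> ?S (Suc m) (insert a A)" using fT assms(2) by (auto simp: card_insert_if)
  qed
  have "sigma (Suc m) (insert a A) x = (\<Sum>T\<in>insert a ` ?S m A. \<Prod>i\<in>T. x i) + sigma (Suc m) A x"
    unfolding sigma_def split using assms fin by (intro sum.union_disjoint) auto
  also have "(\<Sum>T\<in>insert a ` ?S m A. \<Prod>i\<in>T. x i) = (\<Sum>T\<in>?S m A. \<Prod>i\<in>insert a T. x i)"
    using assms(2) by (subst sum.reindex) (auto simp: inj_on_def o_def)
  also have "\<dots> = (\<Sum>T\<in>?S m A. x a * (\<Prod>i\<in>T. x i))"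
    using assms(2) fT by (intro sum.cong refl) (subst prod.insert, auto)
  also have "\<dots> = x a * sigma m A x"
    by (simp add: sigma_def sum_distrib_left)
  finally show ?thesis .
qed

lemma sigma_Suc_remove:
  assumes "finite A" "a \<in> A"
  shows "sigma (Suc m) A x = x a * sigma m (A - {a}) x + sigma (Suc m) (A - {a}) x"
  using sigma_Suc_insert[of "A - {a}" a m x] assms by (simp add: insert_absorb)

lemma coeff_prod_linear:
  fixes x :: "'b \<Rightarrow> real"
  assumes "finite A" "j \<le> card A"
  shows "coeff (\<Prod>a\<in>A. [:complex_of_real (x a), 1:]) (card A - j) = of_real (sigma j A x)"
  using assms
proof (induction A arbitrary: j rule: finite_induct)
  case (insert a A)
  let ?p = "\<Prod>a\<in>A. [:complex_of_real (x a), 1:]"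
  have deg: "degree ?p = card A"
    by (subst degree_prod_eq_sum_degree) auto
  have p: "(\<Prod>a\<in>insert a A. [:complex_of_real (x a), 1:]) = [:of_real (x a), 1:] * ?p"
    using insert by simp
  show ?case
  proof (cases j)
    case 0
    then show ?thesis
      using insert deg insert.IH[of 0] coeff_eq_0[of ?p "Suc (card A)"] by (simp add: p)
  next
    case (Suc i)
    have i: "i \<le> card A" using Suc insert by simp
    show ?thesis
    proof (cases "i = card A")
      case True
      then show ?thesis
        using insert Suc insert.IH[of i] by (simp add: p sigma_Suc_insert sigma_gt_card)
    next
      case False
      then have "card A - i = Suc (card A - Suc i)" using i by simp
      then show ?thesis
        using False i insert Suc insert.IH[of i] insert.IH[of "Suc i"]
        by (simp add: p sigma_Suc_insert)
    qed
  qed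
qed simp

text \<open>The values of \<open>sigma\<close> are the coefficients of the product of the
  \<open>X + x a\<close>. Its \<open>r\<close>-th derivative still has only real roots, and its
  first three derivatives at 0, counted from order zero, are three consecutive coefficients times
  factorials. Laguerre's inequality then gives Newton's with the extra factor
  \<open>(r + 2) / (r + 1)\<close>, which is at least 1 and is dropped.\<close>

lemma newton_sigma:
  fixes x :: "'b \<Rightarrow> real"
  assumes "finite A"
  shows "sigma j A x * sigma (Suc (Suc j)) A x \<le> (sigma (Suc j) A x)\<^sup>2"
proof (cases "Suc (Suc j) \<le> card A")
  case False
  then show ?thesis using assms by (simp add: sigma_gt_card)
next
  case True
  define p where "p = (\<Prod>a\<in>A. [:complex_of_real (x a), 1:])"
  define r where "r = card A - Suc (Suc j)"
  have "p = (\<Prod>a\<in>#image_mset (\<lambda>a. - x a) (mset_set A). [:- of_real a, 1:])"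
    by (simp add: p_def prod_unfold_prod_mset multiset.map_comp o_def)
  then have "real_split p"
    unfolding real_split_def by (intro exI[of _ 1]) auto
  then have rs: "real_split ((pderiv ^^ r) p)" for r
    by (induction r) (auto simp: real_split_pderiv)
  have *: "poly ((pderiv ^^ m) p) 0 = fact m * coeff p m" for m
    by (simp add: poly_0_coeff_0 coeff_higher_pderiv pochhammer_fact)
  have r: "card A - Suc j = Suc r" "card A - j = Suc (Suc r)"
    using True by (auto simp: r_def)
  have c: "coeff p r = of_real (sigma (Suc (Suc j)) A x)"
    "coeff p (Suc r) = of_real (sigma (Suc j) A x)" "coeff p (Suc (Suc r)) = of_real (sigma j A x)"
    using coeff_prod_linear[OF assms, of "Suc (Suc j)" x] coeff_prod_linear[OF assms, of "Suc j" x]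
      coeff_prod_linear[OF assms, of j x] True
    unfolding r by (simp_all add: p_def r_def)
  have "(fact r * sigma (Suc (Suc j)) A x) * (fact (Suc (Suc r)) * sigma j A x)
      \<le> (fact (Suc r) * sigma (Suc j) A x)\<^sup>2"
  proof (rule laguerre_real_split[OF rs[of r]])
    show "poly ((pderiv ^^ r) p) 0 = of_real (fact r * sigma (Suc (Suc j)) A x)"
      using *[of r] c by simp
    show "poly (pderiv ((pderiv ^^ r) p)) 0 = of_real (fact (Suc r) * sigma (Suc j) A x)"
      using *[of "Suc r"] c by simp
    show "poly (pderiv (pderiv ((pderiv ^^ r) p))) 0 = of_real (fact (Suc (Suc r)) * sigma j A x)"
      using *[of "Suc (Suc r)"] c by simp
  qed
  then have "(fact r)\<^sup>2 * (real (Suc r) * (real (Suc (Suc r)) * (sigma j A x * sigma (Suc (Suc j)) A x)))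
     \<le> (fact r)\<^sup>2 * (real (Suc r) * (real (Suc r) * (sigma (Suc j) A x)\<^sup>2))"
    by (simp add: power2_eq_square algebra_simps)
  then have ineq: "real (Suc (Suc r)) * (sigma j A x * sigma (Suc (Suc j)) A x)
      \<le> real (Suc r) * (sigma (Suc j) A x)\<^sup>2"
    by (simp only: mult_le_cancel_left_pos zero_less_power fact_gt_zero of_nat_0_less_iff zero_less_Suc)
  show ?thesis
  proof (rule ccontr)
    assume "\<not> ?thesis"
    then have less: "(sigma (Suc j) A x)\<^sup>2 < sigma j A x * sigma (Suc (Suc j)) A x" by simp
    have "real (Suc r) * (sigma (Suc j) A x)\<^sup>2 < real (Suc r) * (sigma j A x * sigma (Suc (Suc j)) A x)"
      using less by (intro mult_strict_left_mono) auto
    also have "\<dots> \<le> real (Suc (Suc r)) * (sigma j A x * sigma (Suc (Suc j)) A x)"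
      using less zero_le_power2[of "sigma (Suc j) A x"] by (intro mult_right_mono) linarith+
    finally show False using ineq by simp
  qed
qed

lemma in_Gamma_mono: "in_Gamma k A x \<Longrightarrow> j \<le> k \<Longrightarrow> in_Gamma j A x"
  by (auto simp: in_Gamma_def)

lemma in_Gamma_pos: "in_Gamma k A x \<Longrightarrow> finite A \<Longrightarrow> j \<le> k \<Longrightarrow> sigma j A x > 0"
  by (cases "j = 0") (auto simp: in_Gamma_def)

text \<open>Induction on the order. If \<open>sigma (Suc j)\<close> of the smaller set were not
  positive, eliminating \<open>x a\<close> between the expansions of \<open>sigma (Suc j)\<close>
  and \<open>sigma (Suc (Suc j))\<close> of \<open>A\<close> would contradict Newton's
  inequality.\<close>

lemma in_Gamma_remove:
  assumes "finite A" "a \<in> A" "in_Gamma (Suc k) A x"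
  shows "in_Gamma k (A - {a}) x"
proof -
  let ?B = "A - {a}"
  have "j \<le> k \<Longrightarrow> sigma j ?B x > 0" for j
  proof (induction j)
    case 0
    then show ?case using assms(1) by simp
  next
    case (Suc j)
    then have s0: "sigma j ?B x > 0" by simp
    have s1: "x a * sigma j ?B x + sigma (Suc j) ?B x > 0"
      using sigma_Suc_remove[OF assms(1,2), of j x] in_Gamma_pos[OF assms(3,1), of "Suc j"] Suc.prems by simp
    have s2: "x a * sigma (Suc j) ?B x + sigma (Suc (Suc j)) ?B x > 0"
      using sigma_Suc_remove[OF assms(1,2), of "Suc j" x] in_Gamma_pos[OF assms(3,1), of "Suc (Suc j)"] Suc.prems by simp
    have newton: "sigma j ?B x * sigma (Suc (Suc j)) ?B x \<le> (sigma (Suc j) ?B x)\<^sup>2"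
      using assms(1) by (intro newton_sigma) simp
    show ?case
    proof (rule ccontr)
      assume "\<not> ?thesis"
      then have le: "sigma (Suc j) ?B x \<le> 0" by simp
      have "(x a * sigma j ?B x + sigma (Suc j) ?B x) * sigma (Suc j) ?B x \<le> 0"
        using s1 le by (simp add: mult_nonneg_nonpos)
      moreover have "sigma j ?B x * (x a * sigma (Suc j) ?B x + sigma (Suc (Suc j)) ?B x) > 0"
        using s0 s2 by simp
      ultimately show False
        using newton by (simp add: power2_eq_square algebra_simps)
    qed
  qed
  then show ?thesis by (auto simp: in_Gamma_def)
qed

text \<open>Euler's identity: \<open>sigma m (A - {a}) x\<close> is the partial derivative of
  \<open>sigma (Suc m) A\<close> in the variable \<open>x a\<close>.\<close>

lemma sum_sigma_remove:
  assumes "finite A"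
  shows "(\<Sum>a\<in>A. x a * sigma m (A - {a}) x) = real (Suc m) * sigma (Suc m) A x"
  using assms
proof (induction A arbitrary: m rule: finite_induct)
  case empty
  then show ?case by (simp add: sigma_gt_card)
next
  case (insert b A)
  have *: "x a * sigma m (insert b A - {a}) x = (case m of 0 \<Rightarrow> x a * sigma 0 (A - {a}) x
      | Suc i \<Rightarrow> x b * (x a * sigma i (A - {a}) x) + x a * sigma (Suc i) (A - {a}) x)" if "a \<in> A" for a
  proof (cases m)
    case (Suc i)
    have "insert b A - {a} = insert b (A - {a})" using that insert by auto
    then show ?thesis using Suc insert by (simp add: sigma_Suc_insert algebra_simps)
  qed (use insert in simp)
  have "(\<Sum>a\<in>insert b A. x a * sigma m (insert b A - {a}) x)
     = x b * sigma m A x + (\<Sum>a\<in>A. x a * sigma m (insert b A - {a}) x)"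
    using insert by simp
  also have "(\<Sum>a\<in>A. x a * sigma m (insert b A - {a}) x) = (case m of 0 \<Rightarrow> (\<Sum>a\<in>A. x a * sigma 0 (A - {a}) x)
      | Suc i \<Rightarrow> x b * (\<Sum>a\<in>A. x a * sigma i (A - {a}) x) + (\<Sum>a\<in>A. x a * sigma (Suc i) (A - {a}) x))"
    using * insert.hyps by (cases m) (simp_all add: sum.distrib sum_distrib_left)
  also have "x b * sigma m A x + \<dots> = real (Suc m) * sigma (Suc m) (insert b A) x"
    using insert.hyps by (cases m) (simp_all only: nat.case insert.IH, simp_all add: sigma_Suc_insert algebra_simps)
  finally show ?case .
qed

text \<open>Since \<open>a * b / (a + b) = a - a\<^sup>2 / (a + b)\<close>, this is subadditivity of
  \<open>a\<^sup>2 / s\<close> for \<open>s > 0\<close>, together with its decrease in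
  \<open>s\<close>. Only the sums have to be positive; points of the Garding cone may have negative
  entries.\<close>

lemma parallel_sum_superadditive:
  fixes a b a' b' c :: real
  assumes "a + b > 0" "a' + b' > 0" "c \<ge> b + b'"
  shows "a * b / (a + b) + a' * b' / (a' + b') \<le> (a + a') * c / (a + a' + c)"
proof -
  define s s' where "s = a + b" and "s' = a' + b'"
  have pos: "s > 0" "s' > 0" "s + s' > 0" using assms by (auto simp: s_def s'_def)
  have "(a + a')\<^sup>2 * (s * s') \<le> (a\<^sup>2 * s' + a'\<^sup>2 * s) * (s + s')"
  proof -
    have "(a\<^sup>2 * s' + a'\<^sup>2 * s) * (s + s') - (a + a')\<^sup>2 * (s * s') = (a * s' - a' * s)\<^sup>2"
      by (simp add: power2_eq_square algebra_simps)
    then show ?thesis by (metis diff_ge_0_iff_ge zero_le_power2)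
  qed
  then have "(a + a')\<^sup>2 / (s + s') \<le> a\<^sup>2 / s + a'\<^sup>2 / s'"
    using pos by (simp add: field_simps)
  moreover have "(a + a')\<^sup>2 / (a + a' + c) \<le> (a + a')\<^sup>2 / (s + s')"
    using assms pos by (intro divide_left_mono) (auto simp: s_def s'_def)
  moreover have "x * y / (x + y) = x - x\<^sup>2 / (x + y)" if "x + y > 0" for x y :: real
    using that by (simp add: field_simps power2_eq_square)
  ultimately show ?thesis
    using assms by (simp add: s_def s'_def)
qed

text \<open>Homogeneous of degree one, whereas \<open>sigma k / sigma l\<close> has degree
  \<open>k - l\<close>; the product over \<open>{l..<k}\<close> telescopes to the latter.\<close>

definition sigma_quot :: "nat \<Rightarrow> 'b set \<Rightarrow> ('b \<Rightarrow> real) \<Rightarrow> real" where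
  "sigma_quot k A x = sigma (Suc k) A x / sigma k A x"

text \<open>Euler's identity divided by \<open>sigma (Suc k) A x\<close>. Expanding in
  \<open>a\<close> shows that the denominator \<open>x a + sigma_quot k (A - {a}) x\<close> equals
  \<open>sigma (Suc k) A x / sigma k (A - {a}) x\<close>, which also makes it positive.\<close>

lemma sigma_quot_Suc_eq:
  assumes "finite A" "in_Gamma (Suc k) A x"
  shows "real (Suc (Suc k)) * sigma_quot (Suc k) A x
      = (\<Sum>a\<in>A. x a * sigma_quot k (A - {a}) x / (x a + sigma_quot k (A - {a}) x))"
    and "a \<in> A \<Longrightarrow> x a + sigma_quot k (A - {a}) x > 0"
proof -
  have pos: "sigma (Suc k) A x > 0" using in_Gamma_pos[OF assms(2,1)] by simp
  have posB: "sigma k (A - {a}) x > 0" if "a \<in> A" for a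
    using in_Gamma_pos[OF in_Gamma_remove[OF assms(1) that assms(2)]] assms(1) by simp
  have eq: "x a + sigma_quot k (A - {a}) x = sigma (Suc k) A x / sigma k (A - {a}) x" if "a \<in> A" for a
    using posB[OF that] sigma_Suc_remove[OF assms(1) that, of k x] by (simp add: sigma_quot_def field_simps)
  show "a \<in> A \<Longrightarrow> x a + sigma_quot k (A - {a}) x > 0"
    using eq pos posB by simp
  have "real (Suc (Suc k)) * sigma_quot (Suc k) A x = (\<Sum>a\<in>A. x a * sigma (Suc k) (A - {a}) x) / sigma (Suc k) A x"
    unfolding sum_sigma_remove[OF assms(1)] sigma_quot_def by simp
  also have "\<dots> = (\<Sum>a\<in>A. x a * sigma (Suc k) (A - {a}) x / sigma (Suc k) A x)"
    by (simp add: sum_divide_distrib)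
  also have "\<dots> = (\<Sum>a\<in>A. x a * sigma_quot k (A - {a}) x / (x a + sigma_quot k (A - {a}) x))"
  proof (intro sum.cong refl)
    fix a assume a: "a \<in> A"
    show "x a * sigma (Suc k) (A - {a}) x / sigma (Suc k) A x
        = x a * sigma_quot k (A - {a}) x / (x a + sigma_quot k (A - {a}) x)"
      unfolding eq[OF a] using posB[OF a] pos by (simp add: sigma_quot_def)
  qed
  finally show "real (Suc (Suc k)) * sigma_quot (Suc k) A x
      = (\<Sum>a\<in>A. x a * sigma_quot k (A - {a}) x / (x a + sigma_quot k (A - {a}) x))" .
qed

lemma sigma_1: "finite A \<Longrightarrow> sigma (Suc 0) A x = (\<Sum>a\<in>A. x a)"
  using sum_sigma_remove[of A x 0] by simp

lemma in_Gamma_Suc: "in_Gamma (Suc k) A x \<longleftrightarrow> in_Gamma k A x \<and> sigma (Suc k) A x > 0"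
  by (auto simp: in_Gamma_def le_Suc_eq)

text \<open>Marcus--Lopes: sigma_quot_Suc_eq writes the quotient as a sum of parallel sums, which
  are superadditive and monotone.\<close>

lemma sigma_quot_superadditive:
  assumes "finite A" "in_Gamma (Suc k) A x" "in_Gamma (Suc k) A y"
  shows "in_Gamma (Suc k) A (\<lambda>a. x a + y a) \<and> sigma_quot k A x + sigma_quot k A y \<le> sigma_quot k A (\<lambda>a. x a + y a)"
  using assms
proof (induction k arbitrary: A)
  case 0
  have "in_Gamma (Suc 0) A z \<longleftrightarrow> sum z A > 0" for z
    using 0 in_Gamma_Suc[of 0 A z] by (simp add: sigma_1 in_Gamma_def)
  then show ?case
    using 0 by (simp add: sigma_quot_def sigma_1 sum.distrib)
next
  case (Suc k)
  let ?z = "\<lambda>a. x a + y a"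
  have x: "in_Gamma (Suc k) A x" and y: "in_Gamma (Suc k) A y"
    using Suc.prems in_Gamma_mono by (metis le_SucI order_refl)+
  have z: "in_Gamma (Suc k) A ?z" using Suc.IH[OF Suc.prems(1) x y] by simp
  have "sigma_quot k (A - {a}) x + sigma_quot k (A - {a}) y \<le> sigma_quot k (A - {a}) ?z" if "a \<in> A" for a
    using Suc.IH[of "A - {a}"] in_Gamma_remove[OF Suc.prems(1) that] Suc.prems by simp
  then have "real (Suc (Suc k)) * sigma_quot (Suc k) A x + real (Suc (Suc k)) * sigma_quot (Suc k) A y
      \<le> real (Suc (Suc k)) * sigma_quot (Suc k) A ?z"
    unfolding sigma_quot_Suc_eq(1)[OF Suc.prems(1) x] sigma_quot_Suc_eq(1)[OF Suc.prems(1) y] sigma_quot_Suc_eq(1)[OF Suc.prems(1) z]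
      sum.distrib[symmetric]
    using sigma_quot_Suc_eq(2)[OF Suc.prems(1) x] sigma_quot_Suc_eq(2)[OF Suc.prems(1) y]
    by (intro sum_mono parallel_sum_superadditive) auto
  then have le: "sigma_quot (Suc k) A x + sigma_quot (Suc k) A y \<le> sigma_quot (Suc k) A ?z"
    unfolding distrib_left[symmetric] by (rule mult_left_le_imp_le) simp
  \<comment> \<open>The inequality for the quotients also yields the remaining cone condition: the
    quotient at the sum is positive, hence so is its numerator.\<close>
  have "sigma_quot (Suc k) A x > 0" "sigma_quot (Suc k) A y > 0"
    unfolding sigma_quot_def using in_Gamma_pos[OF _ Suc.prems(1)] Suc.prems by auto
  then have "sigma_quot (Suc k) A ?z > 0" using le by simp
  moreover have "sigma (Suc k) A ?z > 0" using in_Gamma_pos[OF z Suc.prems(1)] by simp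
  ultimately have "sigma (Suc (Suc k)) A ?z > 0"
    by (simp add: sigma_quot_def zero_less_divide_iff)
  then show ?case using z le in_Gamma_Suc[of "Suc k" A ?z] by simp
qed

section \<open>Supergradients and doubly stochastic averages\<close>

lemma sigma_scale: "sigma m A (\<lambda>a. t * x a) = t ^ m * sigma m A x"
  unfolding sigma_def sum_distrib_left
  by (intro sum.cong refl) (auto simp: prod.distrib)

lemma in_Gamma_scale: "t > 0 \<Longrightarrow> in_Gamma k A x \<Longrightarrow> in_Gamma k A (\<lambda>a. t * x a)"
  by (auto simp: in_Gamma_def sigma_scale)

lemma sigma_quot_scale: "t > 0 \<Longrightarrow> sigma_quot k A (\<lambda>a. t * x a) = t * sigma_quot k A x"
  by (simp add: sigma_quot_def sigma_scale)

text \<open>\<open>G\<close> is the gradient at \<open>x\<close>; the point is that one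
  \<open>G\<close> serves all directions \<open>y\<close>. The induction over the index set builds
  it from the expansion in the new variable, whose own component is
  \<open>sigma i A x\<close>.\<close>

lemma sigma_line_derivative:
  fixes x :: "'b \<Rightarrow> real"
  assumes "finite A"
  shows "\<exists>G. \<forall>y. ((\<lambda>s. sigma m A (\<lambda>a. x a + s * y a)) has_real_derivative (\<Sum>a\<in>A. G a * y a)) (at 0)"
  using assms
proof (induction A arbitrary: m rule: finite_induct)
  case empty
  then show ?case by (cases m) (simp_all add: sigma_gt_card)
next
  case (insert b A)
  show ?case
  proof (cases m)
    case 0
    then show ?thesis using insert.hyps by (intro exI[of _ "\<lambda>_. 0"]) simp
  next
    case (Suc i)
    obtain G1 where G1: "\<And>y. ((\<lambda>s. sigma i A (\<lambda>a. x a + s * y a)) has_real_derivative (\<Sum>a\<in>A. G1 a * y a)) (at 0)"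
      using insert.IH by blast
    obtain G2 where G2: "\<And>y. ((\<lambda>s. sigma (Suc i) A (\<lambda>a. x a + s * y a)) has_real_derivative (\<Sum>a\<in>A. G2 a * y a)) (at 0)"
      using insert.IH by blast
    define G where "G = (\<lambda>a. if a = b then sigma i A x else x b * G1 a + G2 a)"
    have "((\<lambda>s. sigma m (insert b A) (\<lambda>a. x a + s * y a)) has_real_derivative (\<Sum>a\<in>insert b A. G a * y a)) (at 0)" for y
    proof -
      have "(\<Sum>a\<in>A. G a * y a) = (\<Sum>a\<in>A. (x b * G1 a + G2 a) * y a)"
        using insert.hyps by (intro sum.cong) (auto simp: G_def)
      then have "(\<Sum>a\<in>insert b A. G a * y a) = y b * sigma i A x + x b * (\<Sum>a\<in>A. G1 a * y a) + (\<Sum>a\<in>A. G2 a * y a)"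
        using insert.hyps by (simp add: G_def sum.distrib sum_distrib_left algebra_simps)
      then show ?thesis
        unfolding Suc sigma_Suc_insert[OF insert.hyps]
        by (auto intro!: derivative_eq_intros G1 G2)
    qed
    then show ?thesis by blast
  qed
qed

text \<open>\<open>G\<close> is the gradient at \<open>x\<close>. Homogeneity of degree one,
  differentiated along \<open>x\<close> itself, gives the equality. Superadditivity gives
  \<open>sigma_quot k A x + s * sigma_quot k A y\<close> as a lower bound at
  \<open>x + s * y\<close> for \<open>s > 0\<close>, and the derivative at \<open>s = 0\<close>
  gives the inequality, a linear bound without constant term.\<close>

lemma sigma_quot_supergradient:
  fixes x :: "'b \<Rightarrow> real"
  assumes "finite A" "in_Gamma (Suc k) A x"
  obtains G where "(\<Sum>a\<in>A. G a * x a) = sigma_quot k A x"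
    and "\<And>y. in_Gamma (Suc k) A y \<Longrightarrow> sigma_quot k A y \<le> (\<Sum>a\<in>A. G a * y a)"
proof -
  obtain G1 where G1: "\<And>y. ((\<lambda>s. sigma k A (\<lambda>a. x a + s * y a)) has_real_derivative (\<Sum>a\<in>A. G1 a * y a)) (at 0)"
    using sigma_line_derivative[OF assms(1)] by blast
  obtain G2 where G2: "\<And>y. ((\<lambda>s. sigma (Suc k) A (\<lambda>a. x a + s * y a)) has_real_derivative (\<Sum>a\<in>A. G2 a * y a)) (at 0)"
    using sigma_line_derivative[OF assms(1)] by blast
  define S where "S = sigma k A x"
  define T where "T = sigma (Suc k) A x"
  have S: "S > 0" using in_Gamma_pos[OF assms(2,1)] by (simp add: S_def)
  define G where "G = (\<lambda>a. (G2 a * S - T * G1 a) / (S * S))"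
  have D: "((\<lambda>s. sigma_quot k A (\<lambda>a. x a + s * y a)) has_real_derivative (\<Sum>a\<in>A. G a * y a)) (at 0)" for y
  proof -
    have "(\<Sum>a\<in>A. G a * y a) = ((\<Sum>a\<in>A. G2 a * y a) * S - T * (\<Sum>a\<in>A. G1 a * y a)) / (S * S)"
      using S by (simp add: G_def sum_divide_distrib sum_distrib_left sum_distrib_right sum_subtractf[symmetric]
          left_diff_distrib right_diff_distrib diff_divide_distrib mult_ac)
    then show ?thesis
      unfolding sigma_quot_def using DERIV_divide[OF G2[of y] G1[of y]] S by (simp add: S_def T_def)
  qed
  show ?thesis
  proof
    have "((\<lambda>s. (1 + s) * sigma_quot k A x) has_real_derivative (\<Sum>a\<in>A. G a * x a)) (at 0)"
    proof (rule has_field_derivative_transform_within_open[OF D[of x]])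
      show "open {-1<..<1::real}" "(0::real) \<in> {-1<..<1}" by auto
      fix s :: real assume "s \<in> {-1<..<1}"
      then have "sigma_quot k A (\<lambda>a. (1 + s) * x a) = (1 + s) * sigma_quot k A x"
        by (intro sigma_quot_scale) auto
      then show "sigma_quot k A (\<lambda>a. x a + s * x a) = (1 + s) * sigma_quot k A x"
        by (simp add: distrib_right)
    qed
    moreover have "((\<lambda>s. (1 + s) * sigma_quot k A x) has_real_derivative sigma_quot k A x) (at 0)"
      by (auto intro!: derivative_eq_intros)
    ultimately show "(\<Sum>a\<in>A. G a * x a) = sigma_quot k A x"
      by (rule DERIV_unique)
  next
    fix y assume y: "in_Gamma (Suc k) A y"
    have ge: "sigma_quot k A x + s * sigma_quot k A y \<le> sigma_quot k A (\<lambda>a. x a + s * y a)" if "s > 0" for s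
      using sigma_quot_superadditive[OF assms in_Gamma_scale[OF that y]] sigma_quot_scale[OF that, of k A y] by simp
    show "sigma_quot k A y \<le> (\<Sum>a\<in>A. G a * y a)"
    proof (rule ccontr)
      assume "\<not> ?thesis"
      moreover have "((\<lambda>s. sigma_quot k A (\<lambda>a. x a + s * y a) - s * sigma_quot k A y) has_real_derivative (\<Sum>a\<in>A. G a * y a) - sigma_quot k A y) (at 0)"
        by (auto intro!: derivative_eq_intros D)
      ultimately obtain d where d: "d > 0"
        "\<And>h. h > 0 \<Longrightarrow> h < d \<Longrightarrow> sigma_quot k A (\<lambda>a. x a + h * y a) - h * sigma_quot k A y < sigma_quot k A x"
        using DERIV_neg_dec_right[of "\<lambda>s. sigma_quot k A (\<lambda>a. x a + s * y a) - s * sigma_quot k A y" "(\<Sum>a\<in>A. G a * y a) - sigma_quot k A y" 0] by auto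
      then show False using d(2)[of "d/2"] ge[of "d/2"] by simp
    qed
  qed
qed

section \<open>Symmetric functions of the sums over multi-indices\<close>

lemma sigma_reindex:
  assumes "bij_betw g A A"
  shows "sigma m A (\<lambda>a. x (g a)) = sigma m A x"
proof -
  have inj: "inj_on g T" if "T \<subseteq> A" for T
    using assms that by (meson bij_betw_imp_inj_on inj_on_subset)
  have img: "g ` A = A" using assms by (simp add: bij_betw_def)
  have "bij_betw (image g) {T. T \<subseteq> A \<and> card T = m} {T. T \<subseteq> A \<and> card T = m}"
  proof (rule bij_betw_imageI)
    show "inj_on (image g) {T. T \<subseteq> A \<and> card T = m}"
      using inj[of A] by (auto simp: inj_on_def inj_on_image_eq_iff)
    show "image g ` {T. T \<subseteq> A \<and> card T = m} = {T. T \<subseteq> A \<and> card T = m}"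
    proof (intro equalityI subsetI)
      fix T assume "T \<in> image g ` {T. T \<subseteq> A \<and> card T = m}"
      then obtain R where "T = g ` R" "R \<subseteq> A" "card R = m" by auto
      then show "T \<in> {T. T \<subseteq> A \<and> card T = m}"
        using img card_image[OF inj[of R]] by auto
    next
      fix T assume T: "T \<in> {T. T \<subseteq> A \<and> card T = m}"
      then obtain R where "R \<subseteq> A" "T = g ` R" using img by (metis (mono_tags) mem_Collect_eq subset_image_iff)
      then show "T \<in> image g ` {T. T \<subseteq> A \<and> card T = m}"
        using T card_image[OF inj[of R]] by auto
    qed
  qed
  then have "sigma m A x = (\<Sum>T\<in>{T. T \<subseteq> A \<and> card T = m}. \<Prod>a\<in>g ` T. x a)"
    unfolding sigma_def by (rule sum.reindex_bij_betw[symmetric])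
  also have "\<dots> = sigma m A (\<lambda>a. x (g a))"
    unfolding sigma_def by (intro sum.cong refl) (auto simp: prod.reindex[OF inj])
  finally show ?thesis by simp
qed

lemma finite_multi_idx: "finite (multi_idx n P)"
  unfolding multi_idx_def by (rule finite_subset[of _ "Pow {0..<n}"]) auto

lemma card_multi_idx: "card (multi_idx n P) = n choose P"
  unfolding multi_idx_def by (simp add: n_subsets)

lemma sigma_Lam_permutes:
  assumes "\<pi> permutes {0..<n}"
  shows "sigma m (multi_idx n P) (Lam (\<lambda>i. mu (\<pi> i))) = sigma m (multi_idx n P) (Lam mu)"
proof -
  have inj: "inj_on \<pi> I" for I using assms permutes_inj_on by blast
  have "bij_betw (image \<pi>) (multi_idx n P) (multi_idx n P)"
  proof (rule bij_betw_imageI)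
    show "inj_on (image \<pi>) (multi_idx n P)"
      using inj[of UNIV] by (auto simp: inj_on_def inj_image_eq_iff)
    show "image \<pi> ` multi_idx n P = multi_idx n P"
    proof (intro equalityI subsetI)
      fix T assume "T \<in> image \<pi> ` multi_idx n P"
      then show "T \<in> multi_idx n P"
        using permutes_in_image[OF assms] card_image[OF inj] by (auto simp: multi_idx_def)
    next
      fix T assume T: "T \<in> multi_idx n P"
      then obtain R where "R \<subseteq> {0..<n}" "T = \<pi> ` R"
        using permutes_image[OF assms] unfolding multi_idx_def by (metis (mono_tags) mem_Collect_eq subset_image_iff)
      then show "T \<in> image \<pi> ` multi_idx n P"
        using T card_image[OF inj[of R]] by (auto simp: multi_idx_def)
    qed
  qed
  then have "sigma m (multi_idx n P) (\<lambda>I. Lam mu (\<pi> ` I)) = sigma m (multi_idx n P) (Lam mu)"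
    by (rule sigma_reindex)
  moreover have "Lam mu (\<pi> ` I) = Lam (\<lambda>i. mu (\<pi> i)) I" for I
    unfolding Lam_def by (simp add: sum.reindex[OF inj])
  ultimately show ?thesis by simp
qed

lemma sigma_pos:
  assumes "finite A" "\<And>a. a \<in> A \<Longrightarrow> x a > 0" "m \<le> card A"
  shows "sigma m A x > 0"
  unfolding sigma_def
proof (rule sum_pos)
  show "{T. T \<subseteq> A \<and> card T = m} \<noteq> {}"
    using obtain_subset_with_card_n[OF assms(3)] by blast
qed (use assms in \<open>auto intro!: prod_pos\<close>)

lemma in_Gamma_Lam_pos:
  assumes "P \<ge> 1" "k \<le> n choose P" "\<And>i. i < n \<Longrightarrow> mu i > 0"
  shows "in_Gamma k (multi_idx n P) (Lam mu)"
proof -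
  have "Lam mu I > 0" if I: "I \<in> multi_idx n P" for I
  proof -
    have "I \<noteq> {}" "finite I" using I assms(1) finite_subset[of I "{0..<n}"] by (auto simp: multi_idx_def)
    then show ?thesis unfolding Lam_def using assms(3) I by (intro sum_pos) (auto simp: multi_idx_def)
  qed
  then show ?thesis
    unfolding in_Gamma_def using assms(2) by (auto intro!: sigma_pos simp: finite_multi_idx card_multi_idx)
qed

lemma sum_Lam:
  "(\<Sum>I\<in>multi_idx n P. G I * Lam mu I) = (\<Sum>i<n. (\<Sum>I\<in>{I\<in>multi_idx n P. i \<in> I}. G I) * mu i)"
proof -
  have "(\<Sum>I\<in>multi_idx n P. G I * Lam mu I) = (\<Sum>I\<in>multi_idx n P. \<Sum>i\<in>{i\<in>{..<n}. i \<in> I}. G I * mu i)"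
  proof (intro sum.cong refl)
    fix I assume "I \<in> multi_idx n P"
    then have "{i\<in>{..<n}. i \<in> I} = I" by (auto simp: multi_idx_def)
    then show "G I * Lam mu I = (\<Sum>i\<in>{i\<in>{..<n}. i \<in> I}. G I * mu i)"
      by (simp add: Lam_def sum_distrib_left)
  qed
  also have "\<dots> = (\<Sum>i<n. \<Sum>I\<in>{I\<in>multi_idx n P. i \<in> I}. G I * mu i)"
    by (rule sum.swap_restrict) (simp_all add: finite_multi_idx)
  finally show ?thesis by (simp add: sum_distrib_right)
qed

text \<open>Each index lies in \<open>(n - 1) choose (P - 1)\<close> multi-indices, so
  \<open>sigma 1\<close> of the sums is that multiple of the trace.\<close>

lemma sum_pos_if_in_Gamma:
  assumes "P \<ge> 1" "P \<le> n" "k \<ge> 1" "in_Gamma k (multi_idx n P) (Lam lam)"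
  shows "(\<Sum>i<n. lam i) > 0"
proof -
  have card: "card {I\<in>multi_idx n P. i \<in> I} = (n - 1) choose (P - 1)" if "i < n" for i
  proof -
    let ?R = "{J. J \<subseteq> {0..<n} - {i} \<and> card J = P - 1}"
    have fin: "finite J" if "J \<subseteq> {0..<n} - {i}" for J using that finite_subset by blast
    have "{I\<in>multi_idx n P. i \<in> I} = insert i ` ?R"
    proof (intro equalityI subsetI)
      fix I assume I: "I \<in> {I\<in>multi_idx n P. i \<in> I}"
      then have "I = insert i (I - {i})" "I - {i} \<in> ?R" by (auto simp: multi_idx_def)
      then show "I \<in> insert i ` ?R" by blast
    next
      fix I assume "I \<in> insert i ` ?R"
      then obtain J where J: "I = insert i J" "J \<subseteq> {0..<n} - {i}" "card J = P - 1" by auto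
      then have "card I = P" using fin[of J] assms(1) by (subst J(1), subst card_insert_disjoint) auto
      then show "I \<in> {I\<in>multi_idx n P. i \<in> I}" using J that by (auto simp: multi_idx_def)
    qed
    moreover have "inj_on (insert i) ?R" by (auto simp: inj_on_def)
    ultimately show ?thesis
      using that by (simp add: card_image n_subsets)
  qed
  have "0 < (\<Sum>I\<in>multi_idx n P. 1 * Lam lam I)"
    using in_Gamma_pos[OF assms(4) finite_multi_idx assms(3)] sigma_1[OF finite_multi_idx] by simp
  also have "\<dots> = real ((n - 1) choose (P - 1)) * (\<Sum>i<n. lam i)"
    unfolding sum_Lam by (simp add: card sum_distrib_left)
  finally show ?thesis by (simp add: zero_less_mult_iff)
qed

text \<open>Regrouping the supergradient by single indices gives \<open>c\<close>. The positive
  orthant lies in the cone and the quotient is positive there, so the linear form \<open>c\<close>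
  is positive on it as well; this forces nonnegative coefficients.\<close>

lemma Lam_supergradient:
  assumes "P \<ge> 1" "Suc j \<le> n choose P" "in_Gamma (Suc j) (multi_idx n P) (Lam lam)"
  obtains c where "\<And>i. i < n \<Longrightarrow> c i \<ge> 0"
    and "(\<Sum>i<n. c i * lam i) = sigma_quot j (multi_idx n P) (Lam lam)"
    and "\<And>mu. in_Gamma (Suc j) (multi_idx n P) (Lam mu) \<Longrightarrow>
        sigma_quot j (multi_idx n P) (Lam mu) \<le> (\<Sum>i<n. c i * mu i)"
proof -
  obtain G where G: "(\<Sum>I\<in>multi_idx n P. G I * Lam lam I) = sigma_quot j (multi_idx n P) (Lam lam)"
    "\<And>y. in_Gamma (Suc j) (multi_idx n P) y \<Longrightarrow> sigma_quot j (multi_idx n P) y \<le> (\<Sum>I\<in>multi_idx n P. G I * y I)"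
    using sigma_quot_supergradient[OF finite_multi_idx assms(3)] by blast
  define c where "c = (\<lambda>i. \<Sum>I\<in>{I\<in>multi_idx n P. i \<in> I}. G I)"
  have le: "sigma_quot j (multi_idx n P) (Lam mu) \<le> (\<Sum>i<n. c i * mu i)"
    if "in_Gamma (Suc j) (multi_idx n P) (Lam mu)" for mu
    using G(2)[OF that] by (simp add: sum_Lam c_def)
  have pos: "(\<Sum>i<n. c i * mu i) > 0" if "\<And>i. i < n \<Longrightarrow> mu i > 0" for mu
  proof -
    have *: "in_Gamma (Suc j) (multi_idx n P) (Lam mu)"
      using assms that by (intro in_Gamma_Lam_pos) auto
    then have "sigma_quot j (multi_idx n P) (Lam mu) > 0"
      unfolding sigma_quot_def using in_Gamma_pos[OF * finite_multi_idx] by simp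
    then show ?thesis using le[OF *] by simp
  qed
  have "c i \<ge> 0" if i: "i < n" for i
  proof (rule ccontr)
    assume "\<not> c i \<ge> 0"
    then have neg: "c i < 0" by simp
    \<comment> \<open>If \<open>c i\<close> were negative, raising the \<open>i\<close>-th entry of
      the all-ones vector by this amount would cancel any positive value of the sum of the
      coefficients.\<close>
    define s where "s = \<bar>\<Sum>i<n. c i\<bar> / (- c i)"
    have s: "s \<ge> 0" using neg unfolding s_def by (intro divide_nonneg_pos) auto
    have "0 < (\<Sum>j<n. c j * (1 + (if j = i then s else 0)))"
      using s by (intro pos) auto
    also have "\<dots> = (\<Sum>j<n. c j) + c i * s"
      using i by (simp only: distrib_left sum.distrib mult_1_right) (simp add: if_distrib[of "(*) _"] sum.delta cong: if_cong)
    also have "c i * s = - \<bar>\<Sum>i<n. c i\<bar>"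
      using neg by (simp add: s_def)
    finally show False by simp
  qed
  moreover have "(\<Sum>i<n. c i * lam i) = sigma_quot j (multi_idx n P) (Lam lam)"
    using G(1) by (simp add: sum_Lam c_def)
  ultimately show ?thesis using le that by blast
qed

text \<open>The potential H is a discrete antiderivative of l as a function of c. It serves as the dual
  certificate that the identity is an optimal assignment.\<close>

lemma antimono_potential:
  fixes c l :: "'b \<Rightarrow> real"
  assumes "finite I" "\<And>i j. i \<in> I \<Longrightarrow> j \<in> I \<Longrightarrow> (c i - c j) * (l i - l j) \<le> 0"
  shows "\<exists>H. \<forall>i\<in>I. \<forall>j\<in>I. H i - H j \<le> l j * (c i - c j)"
  using assms
proof (induction "card I" arbitrary: I)
  case 0
  then show ?case by simp
next
  case (Suc m)
  then have "I \<noteq> {}" by auto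
  \<comment> \<open>Because \<open>c\<close> and \<open>l\<close> are oppositely ordered, a maximum
    of \<open>c - l\<close> is at once a maximum of \<open>c\<close> and a minimum of
    \<open>l\<close>.\<close>
  then obtain k where k: "k \<in> I" "\<And>j. j \<in> I \<Longrightarrow> c j - l j \<le> c k - l k"
    using obtains_MAX[of I "\<lambda>j. c j - l j"] Suc.prems(1) Max_ge[of "(\<lambda>j. c j - l j) ` I"]
    by (metis (no_types, lifting) finite_imageI imageI)
  have ck: "c j \<le> c k" and lk: "l k \<le> l j" if "j \<in> I" for j
    using Suc.prems(2)[OF that k(1)] k(2)[OF that] by (auto simp: mult_le_0_iff)
  define J where "J = I - {k}"
  have "m = card J" "finite J" using Suc.hyps(2) Suc.prems(1) k(1) by (auto simp: J_def)
  then obtain H where H: "\<And>i j. i \<in> J \<Longrightarrow> j \<in> J \<Longrightarrow> H i - H j \<le> l j * (c i - c j)"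
    using Suc.hyps(1)[of J] Suc.prems(2) unfolding J_def by (metis DiffD1)
  have I: "I = insert k J" "k \<notin> J" using k by (auto simp: J_def)
  show ?case
  proof (cases "J = {}")
    case True
    then show ?thesis unfolding I by simp
  next
    case False
    \<comment> \<open>The largest value at \<open>k\<close> that the inequalities with
      \<open>k\<close> on the left allow; those with \<open>k\<close> on the right hold because
      \<open>l k\<close> is minimal.\<close>
    define h where "h = Min ((\<lambda>j. H j + l j * (c k - c j)) ` J)"
    have h1: "h \<le> H j + l j * (c k - c j)" if "j \<in> J" for j
      unfolding h_def using that \<open>finite J\<close> by (intro Min_le) auto
    have "h \<in> (\<lambda>j. H j + l j * (c k - c j)) ` J"
      unfolding h_def using False \<open>finite J\<close> by (intro Min_in) auto
    then obtain j0 where j0: "j0 \<in> J" "h = H j0 + l j0 * (c k - c j0)" by blast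
    have h2: "H i + l k * (c k - c i) \<le> h" if i: "i \<in> J" for i
    proof -
      have "l k * (c k - c i) \<le> l j0 * (c k - c i)"
        using ck[of i] lk[of j0] i j0 I by (intro mult_right_mono) auto
      then show ?thesis using H[OF i j0(1)] j0(2) by (simp add: algebra_simps)
    qed
    have "(H(k := h)) i - (H(k := h)) j \<le> l j * (c i - c j)" if ij: "i \<in> I" "j \<in> I" for i j
    proof -
      consider "i = k" "j = k" | "i = k" "j \<in> J" | "i \<in> J" "j = k" | "i \<in> J" "j \<in> J"
        using ij I by blast
      then show ?thesis
      proof cases
        case 2
        then show ?thesis using h1[of j] I(2) by auto
      next
        case 3
        then show ?thesis using h2[of i] I(2) by (auto simp: algebra_simps)
      next
        case 4
        then show ?thesis using H[of i j] I(2) by auto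
      qed simp
    qed
    then show ?thesis by blast
  qed
qed

text \<open>The consequence of Birkhoff's theorem that is needed, by linear programming duality and
  without decomposing \<open>Q\<close>. In a minimizing permutation no swap lowers the sum, so
  \<open>c\<close> and \<open>l'\<close> are oppositely ordered and have a potential
  \<open>H\<close>. Weighting its inequalities by the matrix makes \<open>H\<close> cancel, since
  all row and column sums are 1.\<close>

lemma doubly_stochastic_permutation:
  fixes c l :: "'b \<Rightarrow> real"
  assumes "finite I" "\<And>i j. i \<in> I \<Longrightarrow> j \<in> I \<Longrightarrow> Q i j \<ge> 0"
    and "\<And>i. i \<in> I \<Longrightarrow> (\<Sum>j\<in>I. Q i j) = 1" "\<And>j. j \<in> I \<Longrightarrow> (\<Sum>i\<in>I. Q i j) = 1"
  obtains \<pi> where "\<pi> permutes I" "(\<Sum>i\<in>I. c i * l (\<pi> i)) \<le> (\<Sum>i\<in>I. c i * (\<Sum>j\<in>I. Q i j * l j))"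
proof -
  define f where "f = (\<lambda>\<pi>. \<Sum>i\<in>I. c i * l (\<pi> i))"
  have "finite {\<pi>. \<pi> permutes I}" "{\<pi>. \<pi> permutes I} \<noteq> {}"
    using finite_permutations[OF assms(1)] permutes_id[of I] by blast+
  then obtain \<pi> where \<pi>: "\<pi> permutes I" "\<And>\<rho>. \<rho> permutes I \<Longrightarrow> f \<pi> \<le> f \<rho>"
    using obtains_MIN[of "{\<pi>. \<pi> permutes I}" f] Min_le[of "f ` {\<pi>. \<pi> permutes I}"]
    by (metis (mono_tags, lifting) finite_imageI imageI mem_Collect_eq)
  define l' where "l' = (\<lambda>i. l (\<pi> i))"
  have anti: "(c i - c j) * (l' i - l' j) \<le> 0" if ij: "i \<in> I" "j \<in> I" for i j
  proof (cases "i = j")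
    case False
    have "\<pi> \<circ> Transposition.transpose i j permutes I"
      using \<pi>(1) ij by (intro permutes_compose permutes_swap_id)
    then have "f \<pi> \<le> f (\<pi> \<circ> Transposition.transpose i j)" by (rule \<pi>(2))
    moreover have split: "(\<Sum>k\<in>I. g k) = g i + g j + (\<Sum>k\<in>I - {i, j}. g k)" for g :: "'b \<Rightarrow> real"
      using ij False assms(1) sum.subset_diff[of "{i, j}" I g] by simp
    moreover have "(\<Sum>k\<in>I - {i, j}. c k * l ((\<pi> \<circ> Transposition.transpose i j) k)) = (\<Sum>k\<in>I - {i, j}. c k * l (\<pi> k))"
      by (intro sum.cong) (auto simp: Transposition.transpose_def)
    ultimately have "c i * l' i + c j * l' j \<le> c i * l' j + c j * l' i"
      unfolding f_def l'_def by simp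
    then show ?thesis by (simp add: algebra_simps)
  qed simp
  obtain H where H: "\<And>i j. i \<in> I \<Longrightarrow> j \<in> I \<Longrightarrow> H i - H j \<le> l' j * (c i - c j)"
    using antimono_potential[OF assms(1), of c l'] anti by blast
  have bij: "bij_betw \<pi> I I" using \<pi>(1) permutes_imp_bij by blast
  \<comment> \<open>Columns are relabelled so that the minimizing permutation becomes the
    identity.\<close>
  define Q' where "Q' = (\<lambda>i j. Q i (\<pi> j))"
  have Q': "Q' i j \<ge> 0" if "i \<in> I" "j \<in> I" for i j
    using that assms(2) \<pi>(1) by (simp add: Q'_def permutes_in_image)
  have row: "(\<Sum>j\<in>I. Q' i j) = 1" if "i \<in> I" for i
    using assms(3)[OF that] sum.reindex_bij_betw[OF bij, of "Q i"] by (simp add: Q'_def)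
  have col: "(\<Sum>i\<in>I. Q' i j) = 1" if "j \<in> I" for j
    using assms(4)[of "\<pi> j"] that \<pi>(1) by (simp add: Q'_def permutes_in_image)
  have r: "(\<Sum>i\<in>I. c i * (\<Sum>j\<in>I. Q i j * l j)) = (\<Sum>i\<in>I. \<Sum>j\<in>I. Q' i j * (c i * l' j))"
  proof (intro sum.cong refl)
    fix i assume "i \<in> I"
    have "(\<Sum>j\<in>I. Q i j * l j) = (\<Sum>j\<in>I. Q' i j * l' j)"
      using sum.reindex_bij_betw[OF bij, of "\<lambda>j. Q i j * l j"] by (simp add: Q'_def l'_def)
    then show "c i * (\<Sum>j\<in>I. Q i j * l j) = (\<Sum>j\<in>I. Q' i j * (c i * l' j))"
      by (simp add: sum_distrib_left mult_ac)
  qed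
  have "(\<Sum>i\<in>I. \<Sum>j\<in>I. Q' i j * (H i - H j + c j * l' j)) \<le> (\<Sum>i\<in>I. \<Sum>j\<in>I. Q' i j * (c i * l' j))"
    using H Q' by (intro sum_mono mult_left_mono) (auto simp: algebra_simps)
  moreover have "(\<Sum>i\<in>I. \<Sum>j\<in>I. Q' i j * (H i - H j + c j * l' j))
      = (\<Sum>i\<in>I. \<Sum>j\<in>I. Q' i j * H i) + (\<Sum>i\<in>I. \<Sum>j\<in>I. Q' i j * (c j * l' j - H j))"
    unfolding sum.distrib[symmetric] by (simp add: algebra_simps)
  moreover have "(\<Sum>i\<in>I. \<Sum>j\<in>I. Q' i j * H i) = (\<Sum>i\<in>I. H i)"
    using row by (simp add: sum_distrib_right[symmetric])
  moreover have "(\<Sum>i\<in>I. \<Sum>j\<in>I. Q' i j * (c j * l' j - H j)) = (\<Sum>j\<in>I. c j * l' j - H j)"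
    using col by (subst sum.swap) (simp add: sum_distrib_right[symmetric])
  ultimately show ?thesis
    using that[OF \<pi>(1)] r by (simp add: sum_subtractf l'_def)
qed

text \<open>The quotient is symmetric, so the linear bound holds for every ordering of
  \<open>mu\<close>, in particular for one whose linear form is at most that of the averages. When
  \<open>Q\<close> consists of the squared entries of an orthogonal matrix, the averages are the
  diagonal entries of a symmetric matrix with eigenvalues \<open>mu\<close>.\<close>

lemma sigma_quot_Lam_le_doubly_stochastic:
  assumes "\<And>mu. in_Gamma (Suc j) (multi_idx n P) (Lam mu) \<Longrightarrow>
        sigma_quot j (multi_idx n P) (Lam mu) \<le> (\<Sum>i<n. c i * mu i)"
    and "in_Gamma (Suc j) (multi_idx n P) (Lam mu)"
    and "\<And>i j. i < n \<Longrightarrow> j < n \<Longrightarrow> Q i j \<ge> 0"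
    and "\<And>i. i < n \<Longrightarrow> (\<Sum>j<n. Q i j) = 1" "\<And>j. j < n \<Longrightarrow> (\<Sum>i<n. Q i j) = 1"
  shows "sigma_quot j (multi_idx n P) (Lam mu) \<le> (\<Sum>i<n. c i * (\<Sum>j<n. Q i j * mu j))"
proof -
  obtain \<pi> where \<pi>: "\<pi> permutes {..<n}"
    "(\<Sum>i<n. c i * mu (\<pi> i)) \<le> (\<Sum>i<n. c i * (\<Sum>j<n. Q i j * mu j))"
  proof (rule doubly_stochastic_permutation[of "{..<n}" Q c mu])
    show "Q i j \<ge> 0" if "i \<in> {..<n}" "j \<in> {..<n}" for i j using assms(3) that by simp
    show "(\<Sum>j<n. Q i j) = 1" if "i \<in> {..<n}" for i using assms(4) that by simp
    show "(\<Sum>i<n. Q i j) = 1" if "j \<in> {..<n}" for j using assms(5) that by simp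
  qed (simp, blast)
  have \<pi>0: "\<pi> permutes {0..<n}" using \<pi>(1) by (simp add: atLeast0LessThan)
  have "in_Gamma (Suc j) (multi_idx n P) (Lam (\<lambda>i. mu (\<pi> i)))"
    using assms(2) by (simp add: in_Gamma_def sigma_Lam_permutes[OF \<pi>0])
  then have "sigma_quot j (multi_idx n P) (Lam (\<lambda>i. mu (\<pi> i))) \<le> (\<Sum>i<n. c i * mu (\<pi> i))"
    by (rule assms(1))
  then show ?thesis
    using \<pi>(2) by (simp add: sigma_quot_def sigma_Lam_permutes[OF \<pi>0])
qed

text \<open>Superadditivity for \<open>lam = t / 2 + (lam - t / 2)\<close>. Only half of
  \<open>t\<close> is split off so that the remainder is strictly positive and stays in the
  cone.\<close>

lemma sigma_quot_Lam_lower_bound: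
  assumes "P \<ge> 1" "Suc j \<le> n choose P" "t > 0" "\<And>i. i < n \<Longrightarrow> lam i \<ge> t"
  shows "t / 2 * sigma_quot j (multi_idx n P) (Lam (\<lambda>_. 1)) \<le> sigma_quot j (multi_idx n P) (Lam lam)"
proof -
  let ?A = "multi_idx n P"
  have 1: "in_Gamma (Suc j) ?A (Lam (\<lambda>_. t / 2))"
    using assms by (intro in_Gamma_Lam_pos) auto
  have pos: "lam i - t / 2 > 0" if "i < n" for i using assms(3) assms(4)[OF that] by simp
  have 2: "in_Gamma (Suc j) ?A (Lam (\<lambda>i. lam i - t / 2))"
    using assms pos by (intro in_Gamma_Lam_pos) auto
  have "Lam (\<lambda>_. t / 2) I + Lam (\<lambda>i. lam i - t / 2) I = Lam lam I" for I
    by (simp only: Lam_def sum.distrib[symmetric]) simp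
  then have "sigma_quot j ?A (Lam (\<lambda>_. t / 2)) + sigma_quot j ?A (Lam (\<lambda>i. lam i - t / 2)) \<le> sigma_quot j ?A (Lam lam)"
    using sigma_quot_superadditive[OF finite_multi_idx 1 2] by simp
  moreover have "sigma_quot j ?A (Lam (\<lambda>i. lam i - t / 2)) \<ge> 0"
    unfolding sigma_quot_def using in_Gamma_pos[OF 2 finite_multi_idx] by (simp add: less_imp_le)
  moreover have "Lam (\<lambda>_. t / 2) = (\<lambda>I. t / 2 * Lam (\<lambda>_. 1) I)"
    by (auto simp: Lam_def)
  ultimately show ?thesis
    using sigma_quot_scale[of "t / 2" j ?A "Lam (\<lambda>_. 1)"] assms(3) by simp
qed

lemma prod_sigma_quot:
  assumes "finite A" "in_Gamma k A x" "l \<le> k"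
  shows "(\<Prod>j\<in>{l..<k}. sigma_quot j A x) = sigma k A x / sigma l A x"
  using assms(3,2)
proof (induction k rule: dec_induct)
  case base
  then show ?case using in_Gamma_pos[OF base assms(1), of l] by simp
next
  case (step k)
  then have "sigma k A x > 0" using in_Gamma_pos[OF step.prems assms(1), of k] by simp
  then show ?case
    using step in_Gamma_mono[OF step.prems, of k] by (simp add: sigma_quot_def)
qed

section \<open>Calculus on open sets and along lines\<close>

lemma Ck_continuous_on: "Ck k S f \<Longrightarrow> continuous_on S f"
  by (cases k) auto

lemma Ck_has_derivative:
  assumes "open S" "Ck (Suc k) S f" "x \<in> S"
  shows "(f has_derivative D1 f x) (at x)"
proof -
  have "f differentiable (at x)"
    using assms by (auto simp: differentiable_on_def at_within_open[OF _ assms(1)])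
  then show ?thesis
    unfolding D1_def by (simp add: frechet_derivative_works)
qed

lemma D1_eqI: "(f has_derivative f') (at x) \<Longrightarrow> D1 f x v = f' v"
  unfolding D1_def using frechet_derivative_at by metis

lemma Ck_cong:
  assumes "open S" "\<And>x. x \<in> S \<Longrightarrow> f x = g x" "Ck k S f"
  shows "Ck k S g"
  using assms(2,3)
proof (induction k arbitrary: f g)
  case 0
  then show ?case by (simp cong: continuous_on_cong)
next
  case (Suc k)
  have g: "(g has_derivative D1 f x) (at x)" if "x \<in> S" for x
    using Ck_has_derivative[OF assms(1) Suc.prems(2) that] assms(1) that Suc.prems(1)
    by (rule has_derivative_transform_within_open)
  have "continuous_on S g"
    using Suc.prems continuous_on_cong[of S S f g] by auto
  moreover have "g differentiable_on S"
    using g by (meson differentiable_at_withinI differentiable_def differentiable_on_def)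
  moreover have "Ck k S (\<lambda>x. frechet_derivative g (at x) v)" if "v \<in> Basis" for v
  proof (rule Suc.IH)
    show "Ck k S (\<lambda>x. frechet_derivative f (at x) v)" using Suc.prems that by simp
    fix x assume "x \<in> S"
    then show "frechet_derivative f (at x) v = frechet_derivative g (at x) v"
      using D1_eqI[OF g] by (simp add: D1_def)
  qed
  ultimately show ?case by simp
qed

lemma Ck_SucI:
  assumes "open S" "\<And>x. x \<in> S \<Longrightarrow> (f has_derivative f' x) (at x)"
    and "\<And>v. v \<in> Basis \<Longrightarrow> Ck k S (\<lambda>x. f' x v)"
  shows "Ck (Suc k) S f"
proof -
  have d: "f differentiable_on S"
    using assms(2) by (meson differentiable_at_withinI differentiable_def differentiable_on_def)
  moreover have "Ck k S (\<lambda>x. frechet_derivative f (at x) v)" if "v \<in> Basis" for v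
    using assms(1) _ assms(3)[OF that]
  proof (rule Ck_cong)
    fix x assume "x \<in> S"
    then show "f' x v = frechet_derivative f (at x) v"
      using D1_eqI[OF assms(2)] by (simp add: D1_def)
  qed
  ultimately show ?thesis
    by (simp add: differentiable_imp_continuous_on)
qed

lemma Ck_SucD: "Ck (Suc k) S f \<Longrightarrow> Ck k S f"
  by (induction k arbitrary: f) auto

lemma Ck_le: "Ck k S f \<Longrightarrow> j \<le> k \<Longrightarrow> Ck j S f"
proof (induction k)
  case (Suc k)
  then show ?case using Ck_SucD[OF Suc.prems(1)] by (cases "j = Suc k") auto
qed simp

lemma Ck_const: "open S \<Longrightarrow> Ck k S (\<lambda>x. c)"
proof (induction k arbitrary: c)
  case (Suc k)
  show ?case
    by (rule Ck_SucI[where f' = "\<lambda>_ _. 0"]) (use Suc in auto)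
qed simp

lemma Ck_add:
  assumes "open S"
  shows "Ck k S f \<Longrightarrow> Ck k S g \<Longrightarrow> Ck k S (\<lambda>x. f x + g x)"
proof (induction k arbitrary: f g)
  case (Suc k)
  show ?case
    using assms
  proof (rule Ck_SucI)
    fix x assume "x \<in> S"
    then show "((\<lambda>x. f x + g x) has_derivative (\<lambda>v. D1 f x v + D1 g x v)) (at x)"
      using Ck_has_derivative[OF assms] Suc.prems by (intro has_derivative_add)
  next
    fix v :: 'a assume "v \<in> Basis"
    then show "Ck k S (\<lambda>x. D1 f x v + D1 g x v)"
      using Suc.prems by (intro Suc.IH) (auto simp: D1_def)
  qed
qed (auto intro: continuous_on_add)

lemma Ck_mult:
  assumes "open S"
  shows "Ck k S f \<Longrightarrow> Ck k S g \<Longrightarrow> Ck k S (\<lambda>x. f x * g x)"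
proof (induction k arbitrary: f g)
  case (Suc k)
  show ?case
    using assms
  proof (rule Ck_SucI)
    fix x assume "x \<in> S"
    then show "((\<lambda>x. f x * g x) has_derivative (\<lambda>v. f x * D1 g x v + D1 f x v * g x)) (at x)"
      using Ck_has_derivative[OF assms] Suc.prems by (intro has_derivative_mult)
  next
    fix v :: 'a assume v: "v \<in> Basis"
    show "Ck k S (\<lambda>x. f x * D1 g x v + D1 f x v * g x)"
      using Suc.prems Suc.prems[THEN Ck_SucD] v
      by (intro Ck_add[OF assms] Suc.IH) (auto simp: D1_def)
  qed
qed (auto intro: continuous_on_mult)

lemma Ck_sum:
  assumes "open S" "\<And>i. i \<in> I \<Longrightarrow> Ck k S (f i)"
  shows "Ck k S (\<lambda>x. \<Sum>i\<in>I. f i x)"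
  using assms(2)
  by (induction I rule: infinite_finite_induct) (auto intro: Ck_add Ck_const assms(1))

lemma D1_linear:
  assumes "open S" "Ck (Suc k) S f" "x \<in> S"
  shows "linear (D1 f x)"
  using Ck_has_derivative[OF assms] has_derivative_linear by blast

lemma D1_sum:
  assumes "open S" "Ck (Suc k) S f" "x \<in> S"
  shows "D1 f x v = (\<Sum>b\<in>Basis. (v \<bullet> b) * D1 f x b)"
proof -
  interpret linear "D1 f x" by (rule D1_linear[OF assms])
  have "D1 f x v = D1 f x (\<Sum>b\<in>Basis. (v \<bullet> b) *\<^sub>R b)"
    by (simp add: euclidean_representation)
  then show ?thesis by (simp add: sum scale)
qed

lemma Ck_D1:
  assumes "open S" "Ck (Suc k) S f"
  shows "Ck k S (\<lambda>x. D1 f x v)"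
proof (rule Ck_cong[OF assms(1)])
  show "Ck k S (\<lambda>x. \<Sum>b\<in>Basis. (v \<bullet> b) * D1 f x b)"
    using assms by (intro Ck_sum Ck_mult Ck_const) (auto simp: D1_def)
qed (simp add: D1_sum[OF assms])

lemma Ck_D2:
  assumes "open S" "Ck (Suc (Suc k)) S f"
  shows "Ck k S (\<lambda>x. D2 f x v w)"
  using Ck_D1[OF assms(1) Ck_D1[OF assms]] by (simp add: D2_def D1_def)

lemma Ck_inner: "open S \<Longrightarrow> Ck k S (\<lambda>x. x \<bullet> v)"
proof (induction k)
  case (Suc k)
  have "((\<lambda>x. x \<bullet> v) has_derivative (\<lambda>w. w \<bullet> v)) (at x)" for x
    by (auto intro!: derivative_eq_intros)
  then show ?case using Suc by (intro Ck_SucI[where f' = "\<lambda>_ w. w \<bullet> v"] Ck_const) auto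
qed (auto intro!: continuous_intros)

lemma Ck_inner_self: "open S \<Longrightarrow> Ck k S (\<lambda>x. x \<bullet> x)"
proof (induction k)
  case (Suc k)
  have "((\<lambda>x. x \<bullet> x) has_derivative (\<lambda>w. 2 * (x \<bullet> w))) (at x)" for x :: 'a
    by (auto intro!: derivative_eq_intros simp: inner_commute)
  then show ?case
    using Suc by (intro Ck_SucI[where f' = "\<lambda>x w. 2 * (x \<bullet> w)"] Ck_mult Ck_const Ck_inner) auto
qed (auto intro!: continuous_intros)

lemma Ck_inverse_norm: "Ck k (- {0}) (\<lambda>x. inverse (norm x))"
proof (induction k)
  case 0
  then show ?case by (auto intro!: continuous_intros)
next
  case (Suc k)
  show ?case
  proof (rule Ck_SucI)
    fix x :: 'a assume "x \<in> - {0}"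
    then have "(norm has_derivative (\<lambda>h. h \<bullet> sgn x)) (at x)" "norm x \<noteq> 0"
      by (auto intro: has_derivative_norm)
    then show "((\<lambda>x. inverse (norm x)) has_derivative
        (\<lambda>v. (-1) * ((x \<bullet> v) * (inverse (norm x) * (inverse (norm x) * inverse (norm x)))))) (at x)"
      by (auto intro!: derivative_eq_intros simp: sgn_div_norm inner_commute divide_inverse algebra_simps)
  next
    fix v :: 'a
    show "Ck k (- {0}) (\<lambda>x. (-1) * ((x \<bullet> v) * (inverse (norm x) * (inverse (norm x) * inverse (norm x)))))"
      by (intro Ck_mult Ck_const Suc Ck_inner) auto
  qed auto
qed

lemma Ck_norm: "Ck k (- {0}) norm"
proof (rule Ck_cong)
  show "Ck k (- {0}) (\<lambda>x. (x \<bullet> x) * inverse (norm x))"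
    by (intro Ck_mult Ck_inner_self Ck_inverse_norm) auto
  show "(x \<bullet> x) * inverse (norm x) = norm x" if "x \<in> - {0}" for x :: 'a
    using that by (simp add: dot_square_norm power2_eq_square)
qed auto

section \<open>Derivatives along lines and symmetry of second derivatives\<close>

lemma line_derivative:
  assumes "open S" "Ck (Suc k) S f" "x + t *\<^sub>R v \<in> S"
  shows "((\<lambda>t. f (x + t *\<^sub>R v)) has_real_derivative D1 f (x + t *\<^sub>R v) v) (at t)"
proof -
  have "((\<lambda>t. x + t *\<^sub>R v) has_derivative (\<lambda>h. h *\<^sub>R v)) (at t)"
    by (auto intro!: derivative_eq_intros)
  from has_derivative_compose[OF this Ck_has_derivative[OF assms]]
  have "((\<lambda>t. f (x + t *\<^sub>R v)) has_derivative (\<lambda>h. D1 f (x + t *\<^sub>R v) (h *\<^sub>R v))) (at t)" .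
  moreover have "D1 f (x + t *\<^sub>R v) (h *\<^sub>R v) = D1 f (x + t *\<^sub>R v) v * h" for h
    using linear_scale[OF D1_linear[OF assms]] by simp
  ultimately show ?thesis by (simp add: has_field_derivative_def)
qed

text \<open>The mean value theorem applied first in direction \<open>v\<close>, then in direction
  \<open>w\<close>. The left side is symmetric in \<open>v\<close> and \<open>w\<close>, so the
  other order of application reaches the other mixed derivative at a nearby point.\<close>

lemma mixed_difference:
  fixes f :: "'a::euclidean_space \<Rightarrow> real"
  assumes "open S" "Ck 2 S f" "h > 0"
    and "\<And>s t. 0 \<le> s \<Longrightarrow> s \<le> h \<Longrightarrow> 0 \<le> t \<Longrightarrow> t \<le> h \<Longrightarrow> x + s *\<^sub>R v + t *\<^sub>R w \<in> S"
  shows "\<exists>s t. 0 < s \<and> s < h \<and> 0 < t \<and> t < h \<and>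
    f (x + h *\<^sub>R v + h *\<^sub>R w) - f (x + h *\<^sub>R v) - f (x + h *\<^sub>R w) + f x
      = h * h * D2 f (x + s *\<^sub>R v + t *\<^sub>R w) w v"
proof -
  have C2: "Ck (Suc (Suc 0)) S f" using assms(2) by (simp add: numeral_2_eq_2)
  have C1: "Ck (Suc 0) S (\<lambda>y. D1 f y v)" by (rule Ck_D1[OF assms(1) C2])
  have 1: "((\<lambda>s. f (x + s *\<^sub>R v + t *\<^sub>R w)) has_real_derivative D1 f (x + s *\<^sub>R v + t *\<^sub>R w) v) (at s)"
    if "0 \<le> s" "s \<le> h" "0 \<le> t" "t \<le> h" for s t
    using line_derivative[OF assms(1) C2, of "x + t *\<^sub>R w" s v] assms(4)[OF that] by (simp add: add_ac)
  have "\<exists>s. 0 < s \<and> s < h \<and> (f (x + h *\<^sub>R v + h *\<^sub>R w) - f (x + h *\<^sub>R v + 0 *\<^sub>R w))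
      - (f (x + 0 *\<^sub>R v + h *\<^sub>R w) - f (x + 0 *\<^sub>R v + 0 *\<^sub>R w))
      = (h - 0) * (D1 f (x + s *\<^sub>R v + h *\<^sub>R w) v - D1 f (x + s *\<^sub>R v + 0 *\<^sub>R w) v)"
    using assms(3) by (intro MVT2 DERIV_diff 1) auto
  then obtain s where s: "0 < s" "s < h" "f (x + h *\<^sub>R v + h *\<^sub>R w) - f (x + h *\<^sub>R v) - f (x + h *\<^sub>R w) + f x
      = h * (D1 f (x + s *\<^sub>R v + h *\<^sub>R w) v - D1 f (x + s *\<^sub>R v + 0 *\<^sub>R w) v)"
    by auto
  have "\<exists>t. 0 < t \<and> t < h \<and> D1 f (x + s *\<^sub>R v + h *\<^sub>R w) v - D1 f (x + s *\<^sub>R v + 0 *\<^sub>R w) v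
      = (h - 0) * D1 (\<lambda>y. D1 f y v) (x + s *\<^sub>R v + t *\<^sub>R w) w"
    using assms(3) s(1,2) by (intro MVT2 line_derivative[OF assms(1) C1] assms(4)) auto
  then obtain t where "0 < t" "t < h" "D1 f (x + s *\<^sub>R v + h *\<^sub>R w) v - D1 f (x + s *\<^sub>R v + 0 *\<^sub>R w) v
      = h * D2 f (x + s *\<^sub>R v + t *\<^sub>R w) w v"
    by (auto simp: D2_def D1_def)
  then show ?thesis using s by (intro exI[of _ s] exI[of _ t]) auto
qed

lemma D2_commute:
  fixes f :: "'a::euclidean_space \<Rightarrow> real"
  assumes "open S" "Ck 2 S f" "x \<in> S"
  shows "D2 f x v w = D2 f x w v"
proof (rule ccontr)
  assume ne: "D2 f x v w \<noteq> D2 f x w v"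
  define \<epsilon> where "\<epsilon> = \<bar>D2 f x v w - D2 f x w v\<bar> / 2"
  have \<epsilon>: "\<epsilon> > 0" using ne by (simp add: \<epsilon>_def)
  have cont: "isCont (\<lambda>y. D2 f y a b) x" for a b
    using Ck_continuous_on[OF Ck_D2[OF assms(1), of 0 f a b]] assms
    by (simp add: numeral_2_eq_2 continuous_on_eq_continuous_at)
  obtain r where r: "r > 0" "ball x r \<subseteq> S" using assms openE by blast
  obtain d1 where d1: "d1 > 0" "\<And>y. dist y x < d1 \<Longrightarrow> dist (D2 f y v w) (D2 f x v w) < \<epsilon>"
    using cont[of v w] \<epsilon> unfolding continuous_at_eps_delta by blast
  obtain d2 where d2: "d2 > 0" "\<And>y. dist y x < d2 \<Longrightarrow> dist (D2 f y w v) (D2 f x w v) < \<epsilon>"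
    using cont[of w v] \<epsilon> unfolding continuous_at_eps_delta by blast
  define d where "d = min r (min d1 d2)"
  \<comment> \<open>Small enough that the whole parallelogram spanned by
    \<open>h *\<^sub>R v\<close> and \<open>h *\<^sub>R w\<close> lies within distance
    \<open>d\<close>; the summand 1 covers vanishing directions.\<close>
  define h where "h = d / (2 * (norm v + norm w + 1))"
  have d: "d > 0" using r d1 d2 by (simp add: d_def)
  have nn: "norm v + norm w + 1 > 0" by (smt (verit) norm_ge_zero)
  have h: "h > 0" using d nn by (simp add: h_def)
  have close: "dist (x + s *\<^sub>R v + t *\<^sub>R w) x < d" if "0 \<le> s" "s \<le> h" "0 \<le> t" "t \<le> h" for s t
  proof -
    have "dist (x + s *\<^sub>R v + t *\<^sub>R w) x = norm (s *\<^sub>R v + t *\<^sub>R w)" by (simp add: dist_norm)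
    also have "\<dots> \<le> s * norm v + t * norm w"
      using norm_triangle_ineq[of "s *\<^sub>R v" "t *\<^sub>R w"] that by simp
    also have "\<dots> \<le> h * norm v + h * norm w"
      using that by (intro add_mono mult_right_mono) auto
    also have "\<dots> \<le> h * (norm v + norm w + 1)"
      using h by (simp add: algebra_simps)
    also have "\<dots> = d / 2" using nn unfolding h_def by (metis less_irrefl mult.commute nonzero_eq_divide_eq divide_divide_eq_left)
    finally show ?thesis using d by simp
  qed
  have S: "x + s *\<^sub>R v + t *\<^sub>R w \<in> S" if "0 \<le> s" "s \<le> h" "0 \<le> t" "t \<le> h" for s t
    using close[OF that] r(2) by (auto simp: d_def dist_commute subset_eq)
  obtain s t where st: "0 < s" "s < h" "0 < t" "t < h"
    "f (x + h *\<^sub>R v + h *\<^sub>R w) - f (x + h *\<^sub>R v) - f (x + h *\<^sub>R w) + f x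
      = h * h * D2 f (x + s *\<^sub>R v + t *\<^sub>R w) w v"
    using mixed_difference[OF assms(1,2) h, of x v w] S by metis
  have S': "x + s *\<^sub>R w + t *\<^sub>R v \<in> S" if "0 \<le> s" "s \<le> h" "0 \<le> t" "t \<le> h" for s t
    using S[OF that(3,4,1,2)] by (simp add: add_ac)
  obtain s' t' where st': "0 < s'" "s' < h" "0 < t'" "t' < h"
    "f (x + h *\<^sub>R w + h *\<^sub>R v) - f (x + h *\<^sub>R w) - f (x + h *\<^sub>R v) + f x
      = h * h * D2 f (x + s' *\<^sub>R w + t' *\<^sub>R v) v w"
    using mixed_difference[OF assms(1,2) h, of x w v] S' by metis
  have tri: "\<bar>a - b\<bar> \<le> \<bar>c - a\<bar> + \<bar>c - b\<bar>" for a b c :: real by linarith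
  have "f (x + h *\<^sub>R w + h *\<^sub>R v) = f (x + h *\<^sub>R v + h *\<^sub>R w)" by (simp add: add_ac)
  then have "h * h * D2 f (x + s *\<^sub>R v + t *\<^sub>R w) w v = h * h * D2 f (x + s' *\<^sub>R w + t' *\<^sub>R v) v w"
    using st(5) st'(5) by linarith
  then have "D2 f (x + s *\<^sub>R v + t *\<^sub>R w) w v = D2 f (x + t' *\<^sub>R v + s' *\<^sub>R w) v w"
    using h by (simp add: add_ac)
  moreover have "dist (D2 f (x + s *\<^sub>R v + t *\<^sub>R w) w v) (D2 f x w v) < \<epsilon>"
    using close[of s t] st by (intro d2(2)) (auto simp: d_def)
  moreover have "dist (D2 f (x + t' *\<^sub>R v + s' *\<^sub>R w) v w) (D2 f x v w) < \<epsilon>"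
    using close[of t' s'] st' by (intro d1(2)) (auto simp: d_def)
  ultimately show False
    using tri[of "D2 f x v w" "D2 f x w v" "D2 f (x + s *\<^sub>R v + t *\<^sub>R w) w v"]
    unfolding \<epsilon>_def dist_real_def by simp
qed

text \<open>A first derivative near 0 and a second derivative at 0 only, with both values recorded.
  The local form admits \<open>ln (f t)\<close> when positivity of \<open>f\<close> is known only at
  \<open>t = 0\<close>.\<close>

definition deriv2 :: "(real \<Rightarrow> real) \<Rightarrow> real \<Rightarrow> real \<Rightarrow> bool" where
  "deriv2 g a b \<longleftrightarrow> (\<exists>g'. (\<forall>\<^sub>F t in nhds 0. (g has_real_derivative g' t) (at t)) \<and> g' 0 = a \<and>
     (g' has_real_derivative b) (at 0))"

lemma deriv2_has_derivative: "deriv2 g a b \<Longrightarrow> (g has_real_derivative a) (at 0)"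
  unfolding deriv2_def by (auto dest: eventually_nhds_x_imp_x)

lemma deriv2_line:
  assumes "open S" "Ck 2 S f" "x \<in> S"
  shows "deriv2 (\<lambda>t. f (x + t *\<^sub>R v)) (D1 f x v) (D2 f x v v)"
proof -
  have C2: "Ck (Suc (Suc 0)) S f" using assms(2) by (simp add: numeral_2_eq_2)
  have C1: "Ck (Suc 0) S (\<lambda>y. D1 f y v)" by (rule Ck_D1[OF assms(1) C2])
  have "open ((\<lambda>t. x + t *\<^sub>R v) -` S)"
    by (intro continuous_open_vimage assms continuous_intros)
  moreover have "0 \<in> (\<lambda>t. x + t *\<^sub>R v) -` S" using assms by simp
  ultimately have ev: "\<forall>\<^sub>F t in nhds 0. t \<in> (\<lambda>t. x + t *\<^sub>R v) -` S"
    by (rule eventually_nhds_in_open)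
  show ?thesis
    unfolding deriv2_def
  proof (intro exI conjI)
    show "\<forall>\<^sub>F t in nhds 0. ((\<lambda>t. f (x + t *\<^sub>R v)) has_real_derivative D1 f (x + t *\<^sub>R v) v) (at t)"
      using ev by eventually_elim (auto intro: line_derivative[OF assms(1) C2])
    show "((\<lambda>t. D1 f (x + t *\<^sub>R v) v) has_real_derivative D2 f x v v) (at 0)"
      using line_derivative[OF assms(1) C1, of x 0 v] assms by (simp add: D2_def D1_def)
  qed simp
qed

lemma deriv2_const: "deriv2 (\<lambda>_. c) 0 0"
  unfolding deriv2_def by (intro exI[of _ "\<lambda>_. 0"]) auto

lemma deriv2_add:
  assumes "deriv2 f a b" "deriv2 g c d"
  shows "deriv2 (\<lambda>t. f t + g t) (a + c) (b + d)"
proof -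
  obtain f' where f': "\<forall>\<^sub>F t in nhds 0. (f has_real_derivative f' t) (at t)" "f' 0 = a"
    "(f' has_real_derivative b) (at 0)" using assms(1) unfolding deriv2_def by blast
  obtain g' where g': "\<forall>\<^sub>F t in nhds 0. (g has_real_derivative g' t) (at t)" "g' 0 = c"
    "(g' has_real_derivative d) (at 0)" using assms(2) unfolding deriv2_def by blast
  show ?thesis
    unfolding deriv2_def
  proof (intro exI[of _ "\<lambda>t. f' t + g' t"] conjI)
    show "\<forall>\<^sub>F t in nhds 0. ((\<lambda>t. f t + g t) has_real_derivative f' t + g' t) (at t)"
      using f'(1) g'(1) by eventually_elim (rule DERIV_add)
  qed (use f' g' in \<open>auto intro!: derivative_eq_intros\<close>)
qed

lemma deriv2_mult:
  assumes "deriv2 f a b" "deriv2 g c d"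
  shows "deriv2 (\<lambda>t. f t * g t) (a * g 0 + f 0 * c) (b * g 0 + 2 * a * c + f 0 * d)"
proof -
  obtain f' where f': "\<forall>\<^sub>F t in nhds 0. (f has_real_derivative f' t) (at t)" "f' 0 = a"
    "(f' has_real_derivative b) (at 0)" using assms(1) unfolding deriv2_def by blast
  obtain g' where g': "\<forall>\<^sub>F t in nhds 0. (g has_real_derivative g' t) (at t)" "g' 0 = c"
    "(g' has_real_derivative d) (at 0)" using assms(2) unfolding deriv2_def by blast
  show ?thesis
    unfolding deriv2_def
  proof (intro exI[of _ "\<lambda>t. f' t * g t + f t * g' t"] conjI)
    show "\<forall>\<^sub>F t in nhds 0. ((\<lambda>t. f t * g t) has_real_derivative f' t * g t + f t * g' t) (at t)"
      using f'(1) g'(1) by eventually_elim (auto intro!: derivative_eq_intros)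
    show "((\<lambda>t. f' t * g t + f t * g' t) has_real_derivative b * g 0 + 2 * a * c + f 0 * d) (at 0)"
      using f'(2) g'(2)
      by (auto intro!: derivative_eq_intros f'(3) g'(3) deriv2_has_derivative[OF assms(1)]
          deriv2_has_derivative[OF assms(2)])
  qed (use f' g' in auto)
qed

lemma deriv2_cmult: "deriv2 f a b \<Longrightarrow> deriv2 (\<lambda>t. c * f t) (c * a) (c * b)"
  using deriv2_mult[OF deriv2_const[of c], of f a b] by simp

lemma deriv2_sum:
  "(\<And>i. i \<in> I \<Longrightarrow> deriv2 (f i) (a i) (b i)) \<Longrightarrow>
    deriv2 (\<lambda>t. \<Sum>i\<in>I. f i t) (\<Sum>i\<in>I. a i) (\<Sum>i\<in>I. b i)"
  by (induction I rule: infinite_finite_induct) (auto intro: deriv2_const deriv2_add)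

lemma deriv2_ln:
  assumes "deriv2 f a b" "f 0 > 0"
  shows "deriv2 (\<lambda>t. ln (f t)) (a / f 0) (b / f 0 - (a / f 0)\<^sup>2)"
proof -
  obtain f' where f': "\<forall>\<^sub>F t in nhds 0. (f has_real_derivative f' t) (at t)" "f' 0 = a"
    "(f' has_real_derivative b) (at 0)" using assms(1) unfolding deriv2_def by blast
  have f0: "(f has_real_derivative a) (at 0)" by (rule deriv2_has_derivative[OF assms(1)])
  then have "isCont f 0" by (rule DERIV_isCont)
  then have "(f \<longlongrightarrow> f 0) (nhds 0)" by (simp add: isCont_def tendsto_at_iff_tendsto_nhds)
  then have pos: "\<forall>\<^sub>F t in nhds 0. f t > 0" using assms(2) by (rule order_tendstoD)
  show ?thesis
    unfolding deriv2_def
  proof (intro exI[of _ "\<lambda>t. f' t / f t"] conjI)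
    show "\<forall>\<^sub>F t in nhds 0. ((\<lambda>t. ln (f t)) has_real_derivative f' t / f t) (at t)"
      using f'(1) pos by eventually_elim (auto intro!: derivative_eq_intros)
    show "((\<lambda>t. f' t / f t) has_real_derivative b / f 0 - (a / f 0)\<^sup>2) (at 0)"
      using DERIV_divide[OF f'(3) f0] assms(2) f'(2)
      by (simp add: field_simps power2_eq_square)
  qed (use f' in auto)
qed

lemma deriv2_local_max:
  assumes "deriv2 g a b" "\<forall>\<^sub>F t in nhds 0. g t \<le> g 0"
  shows "b \<le> 0"
proof (rule ccontr)
  assume "\<not> b \<le> 0"
  then have b: "b > 0" by simp
  obtain g' where g': "\<forall>\<^sub>F t in nhds 0. (g has_real_derivative g' t) (at t)" "g' 0 = a"
    "(g' has_real_derivative b) (at 0)" using assms(1) unfolding deriv2_def by blast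
  obtain d where d: "d > 0" "\<And>t. \<bar>t\<bar> < d \<Longrightarrow> (g has_real_derivative g' t) (at t) \<and> g t \<le> g 0"
    using eventually_conj[OF g'(1) assms(2)] unfolding eventually_nhds_metric by (auto simp: dist_real_def)
  have "a = 0"
    using DERIV_local_max[OF deriv2_has_derivative[OF assms(1)] d(1)] d(2) by simp
  then obtain d' where d': "d' > 0" "\<And>h. h > 0 \<Longrightarrow> h < d' \<Longrightarrow> g' h > 0"
    using DERIV_pos_inc_right[OF g'(3) b] g'(2) by auto
  define h where "h = min d d' / 2"
  have h: "h > 0" "h < d" "h < d'" using d d' by (auto simp: h_def)
  have "\<exists>z. 0 < z \<and> z < h \<and> g h - g 0 = (h - 0) * g' z"
    using h d(2) by (intro MVT2) auto
  then obtain z where z: "0 < z" "z < h" "g h - g 0 = h * g' z" by auto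
  have "h * g' z > 0" using d'(2)[of z] z h by simp
  then show False using z(3) d(2)[of h] h by simp
qed

text \<open>This is the norm of \<open>x + t *\<^sub>R e\<close> for orthonormal \<open>x\<close>
  and \<open>e\<close>. Its second derivative is the source of the zeroth-order terms in the Hessian
  along a rotating frame.\<close>

lemma deriv2_sqrt: "deriv2 (\<lambda>t. sqrt (1 + t\<^sup>2)) 0 1"
proof -
  have D: "((\<lambda>t. sqrt (1 + t\<^sup>2)) has_real_derivative t / sqrt (1 + t\<^sup>2)) (at t)" for t :: real
  proof -
    have "1 + t\<^sup>2 > 0" by (simp add: add_pos_nonneg)
    moreover have "((\<lambda>t. 1 + t\<^sup>2) has_real_derivative 2 * t) (at t)"
      by (auto intro!: derivative_eq_intros)
    ultimately have "((\<lambda>t. sqrt (1 + t\<^sup>2)) has_real_derivative inverse (sqrt (1 + t\<^sup>2)) / 2 * (2 * t)) (at t)"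
      by (rule DERIV_chain2[OF DERIV_real_sqrt])
    then show ?thesis by (simp add: field_simps)
  qed
  show ?thesis
    unfolding deriv2_def
  proof (rule exI[of _ "\<lambda>t. t / sqrt (1 + t\<^sup>2)"], intro conjI)
    show "\<forall>\<^sub>F t in nhds 0. ((\<lambda>t. sqrt (1 + t\<^sup>2)) has_real_derivative t / sqrt (1 + t\<^sup>2)) (at t)"
      using D by simp
    show "((\<lambda>t. t / sqrt (1 + t\<^sup>2)) has_real_derivative 1) (at 0)"
      using DERIV_divide[OF DERIV_ident D[of 0]] by simp
  qed simp
qed

section \<open>The homogeneous extension\<close>

lemma ext0_scale: "t > 0 \<Longrightarrow> ext0 u (t *\<^sub>R y) = ext0 u y"
  by (simp add: ext0_def mult.assoc mult.commute[of t])

lemma ext0_unit: "norm y = 1 \<Longrightarrow> ext0 u y = u y"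
  by (simp add: ext0_def)

definition hom1 :: "('a::euclidean_space \<Rightarrow> real) \<Rightarrow> 'a \<Rightarrow> real" where
  "hom1 u y = norm y * ext0 u y"

lemma open_punctured: "open (- {0::'a::euclidean_space})" by auto

lemma Ck_hom1: "Ck_sphere k u \<Longrightarrow> Ck k (- {0}) (hom1 u)"
  unfolding Ck_sphere_def hom1_def by (intro Ck_mult Ck_norm) auto

lemma D1_homogeneous:
  assumes "\<And>y. y \<noteq> 0 \<Longrightarrow> f (t *\<^sub>R y) = c * f y" "t > 0" "Ck (Suc k) (- {0}) f" "y \<noteq> 0"
  shows "t * D1 f (t *\<^sub>R y) v = c * D1 f y v"
proof -
  have ty: "t *\<^sub>R y \<in> - {0}" using assms by simp
  have "((\<lambda>y. t *\<^sub>R y) has_derivative (\<lambda>v. t *\<^sub>R v)) (at y)"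
    by (auto intro!: derivative_eq_intros)
  from has_derivative_compose[OF this Ck_has_derivative[OF open_punctured assms(3) ty]]
  have "((\<lambda>y. f (t *\<^sub>R y)) has_derivative (\<lambda>v. D1 f (t *\<^sub>R y) (t *\<^sub>R v))) (at y)" .
  moreover have "((\<lambda>y. f (t *\<^sub>R y)) has_derivative (\<lambda>v. c * D1 f y v)) (at y)"
  proof (rule has_derivative_transform_within_open[where s = "- {0}"])
    show "((\<lambda>y. c * f y) has_derivative (\<lambda>v. c * D1 f y v)) (at y)"
      using assms by (intro has_derivative_mult_right Ck_has_derivative[OF open_punctured assms(3)]) auto
  qed (use assms in auto)
  ultimately have "D1 f (t *\<^sub>R y) (t *\<^sub>R v) = c * D1 f y v"
    using has_derivative_unique by metis
  then show ?thesis
    using linear_scale[OF D1_linear[OF open_punctured assms(3) ty], of t v] by simp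
qed

lemma D1_radial_zero:
  assumes "\<And>t y. t > 0 \<Longrightarrow> f (t *\<^sub>R y) = f y" "Ck (Suc k) (- {0}) f" "y \<noteq> 0"
  shows "D1 f y y = 0"
proof -
  have "((\<lambda>t. f (y + t *\<^sub>R y)) has_real_derivative D1 f y y) (at 0)"
    using line_derivative[OF open_punctured assms(2), of y 0 y] assms(3) by simp
  moreover have "((\<lambda>t. f (y + t *\<^sub>R y)) has_real_derivative 0) (at 0)"
  proof (rule has_field_derivative_transform_within_open[where f = "\<lambda>_. f y" and S = "{-1<..}"])
    fix t :: real assume "t \<in> {-1<..}"
    then show "f y = f (y + t *\<^sub>R y)" using assms(1)[of "1 + t" y] by (simp add: scaleR_left_distrib)
  qed auto
  ultimately show ?thesis by (rule DERIV_unique)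
qed

lemma D2_D1: "D2 f x v w = D1 (\<lambda>y. D1 f y w) x v"
  by (simp add: D2_def D1_def)

lemma D1_hom1_scale:
  assumes "Ck (Suc k) (- {0}) (hom1 u)" "t > 0" "y \<noteq> 0"
  shows "D1 (hom1 u) (t *\<^sub>R y) w = D1 (hom1 u) y w"
proof -
  have "t * D1 (hom1 u) (t *\<^sub>R y) w = t * D1 (hom1 u) y w"
    using assms by (intro D1_homogeneous) (auto simp: hom1_def ext0_scale)
  then show ?thesis using assms by simp
qed

lemma D2_hom1_scale:
  assumes "Ck (Suc (Suc k)) (- {0}) (hom1 u)" "t > 0" "y \<noteq> 0"
  shows "t * D2 (hom1 u) (t *\<^sub>R y) v w = D2 (hom1 u) y v w"
  using D1_homogeneous[of "\<lambda>y. D1 (hom1 u) y w" t 1 k y v]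
    D1_hom1_scale[OF assms(1,2)] Ck_D1[OF open_punctured assms(1)] assms
  by (simp add: D2_D1)

text \<open>The gradient of a 1-homogeneous function is constant along rays.\<close>

lemma D2_hom1_radial:
  assumes "Ck (Suc (Suc k)) (- {0}) (hom1 u)" "y \<noteq> 0"
  shows "D2 (hom1 u) y y w = 0"
proof -
  have "D1 (hom1 u) (t *\<^sub>R z) w = D1 (hom1 u) z w" if "t > 0" for t z
    using D1_hom1_scale[OF assms(1) that] by (cases "z = 0") auto
  then show ?thesis
    unfolding D2_D1 using Ck_D1[OF open_punctured assms(1)] assms(2) by (intro D1_radial_zero)
qed

text \<open>In the second derivative of \<open>norm y * ext0 u y\<close> every term with a factor
  \<open>x \<bullet> Y\<close> or \<open>X \<bullet> x\<close> vanishes; differentiating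
  \<open>y \<bullet> Y\<close> leaves the zeroth-order term. The normal correction in
  \<open>shess\<close> is zero because \<open>ext0 u\<close> is constant along rays.\<close>

lemma D2_hom1_tangent:
  assumes "Ck_sphere 2 u" "norm x = 1" "X \<bullet> x = 0" "Y \<bullet> x = 0"
  shows "D2 (hom1 u) x X Y = shess u x X Y + u x * (X \<bullet> Y)"
proof -
  let ?E = "ext0 u"
  have C2: "Ck (Suc (Suc 0)) (- {0}) ?E" using assms(1) by (simp add: Ck_sphere_def numeral_2_eq_2)
  have C1: "Ck (Suc 0) (- {0}) (\<lambda>y. D1 ?E y Y)" by (rule Ck_D1[OF open_punctured C2])
  have x: "x \<in> - {0}" using assms(2) by auto
  have D1eq: "D1 (hom1 u) y Y = norm y * D1 ?E y Y + (y \<bullet> Y) * (inverse (norm y) * ?E y)" if "y \<in> - {0}" for y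
  proof -
    have "(norm has_derivative (\<lambda>h. h \<bullet> sgn y)) (at y)"
      using that by (auto intro: has_derivative_norm)
    then have "(hom1 u has_derivative (\<lambda>h. norm y * D1 ?E y h + (h \<bullet> sgn y) * ?E y)) (at y)"
      unfolding hom1_def[abs_def]
      by (intro has_derivative_mult Ck_has_derivative[OF open_punctured C2 that])
    from D1_eqI[OF this, of Y] show ?thesis
      by (simp add: sgn_div_norm inner_commute)
  qed
  have n: "(norm has_derivative (\<lambda>h. h \<bullet> sgn x)) (at x)"
    using x by (auto intro: has_derivative_norm)
  define R where "R = (\<lambda>y::'a. inverse (norm y) * ?E y)"
  have "Ck (Suc 0) (- {0}) R"
    unfolding R_def using Ck_SucD[OF C2] by (intro Ck_mult Ck_inverse_norm) auto
  then have R: "(R has_derivative D1 R x) (at x)"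
    by (rule Ck_has_derivative[OF open_punctured _ x])
  have I: "((\<lambda>y. y \<bullet> Y) has_derivative (\<lambda>h. h \<bullet> Y)) (at x)"
    by (auto intro!: derivative_eq_intros)
  have "((\<lambda>y. norm y * D1 ?E y Y + (y \<bullet> Y) * R y) has_derivative
      (\<lambda>h. (norm x * D1 (\<lambda>y. D1 ?E y Y) x h + (h \<bullet> sgn x) * D1 ?E x Y) + ((x \<bullet> Y) * D1 R x h + (h \<bullet> Y) * R x))) (at x)"
    by (intro has_derivative_add has_derivative_mult n I R Ck_has_derivative[OF open_punctured C1 x])
  then have "((\<lambda>y. D1 (hom1 u) y Y) has_derivative
      (\<lambda>h. (norm x * D1 (\<lambda>y. D1 ?E y Y) x h + (h \<bullet> sgn x) * D1 ?E x Y) + ((x \<bullet> Y) * D1 R x h + (h \<bullet> Y) * R x))) (at x)"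
    by (rule has_derivative_transform_within_open[OF _ open_punctured x]) (simp add: D1eq R_def)
  from D1_eqI[OF this, of X]
  have "D2 (hom1 u) x X Y = D2 ?E x X Y + u x * (X \<bullet> Y)"
    using assms by (simp add: D2_D1 R_def ext0_unit sgn_div_norm inner_commute)
  moreover have "D1 ?E x x = 0"
    using x by (intro D1_radial_zero[OF _ C2]) (auto simp: ext0_scale)
  ultimately show ?thesis by (simp add: shess_def)
qed

lemma D2_linear_left:
  assumes "open S" "Ck 2 S f" "x \<in> S"
  shows "linear (\<lambda>v. D2 f x v w)"
proof -
  have "Ck (Suc (Suc 0)) S f" using assms(2) by (simp add: numeral_2_eq_2)
  then have "Ck (Suc 0) S (\<lambda>y. D1 f y w)" by (rule Ck_D1[OF assms(1)])
  then have "linear (D1 (\<lambda>y. D1 f y w) x)"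
    by (rule D1_linear[OF assms(1) _ assms(3)])
  then show ?thesis by (simp add: D2_D1[abs_def])
qed

lemma D2_bilinear:
  assumes "open S" "Ck 2 S f" "x \<in> S"
  shows "bilinear (D2 f x)"
  unfolding bilinear_def
  using D2_linear_left[OF assms] D2_commute[OF assms] by simp

section \<open>Orthonormal tangent frames and their rotation\<close>

definition oframe :: "nat \<Rightarrow> 'a::euclidean_space \<Rightarrow> (nat \<Rightarrow> 'a) \<Rightarrow> bool" where
  "oframe n x e \<longleftrightarrow> norm x = 1 \<and> (\<forall>i<n. e i \<bullet> x = 0) \<and>
     (\<forall>i<n. \<forall>j<n. e i \<bullet> e j = (if i = j then 1 else 0))"

text \<open>A nonzero remainder, together with \<open>x\<close> and the frame, would give
  \<open>n + 2\<close> pairwise orthogonal nonzero vectors in dimension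
  \<open>n + 1\<close>.\<close>

lemma oframe_expansion:
  fixes x :: "'a::euclidean_space"
  assumes "oframe n x e" "DIM('a) = Suc n" "X \<bullet> x = 0"
  shows "X = (\<Sum>i<n. (X \<bullet> e i) *\<^sub>R e i)"
proof (rule ccontr)
  assume ne: "X \<noteq> (\<Sum>i<n. (X \<bullet> e i) *\<^sub>R e i)"
  define r where "r = X - (\<Sum>i<n. (X \<bullet> e i) *\<^sub>R e i)"
  have r0: "r \<noteq> 0" using ne by (simp add: r_def)
  have x: "norm x = 1" "x \<noteq> 0" and ex: "\<And>i. i < n \<Longrightarrow> e i \<bullet> x = 0"
    and ee: "\<And>i j. i < n \<Longrightarrow> j < n \<Longrightarrow> e i \<bullet> e j = (if i = j then 1 else 0)"
    using assms(1) by (auto simp: oframe_def)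
  have rx: "r \<bullet> x = 0"
    unfolding r_def using assms(3) ex by (simp add: inner_diff_left inner_sum_left)
  have re: "r \<bullet> e j = 0" if j: "j < n" for j
  proof -
    have "(\<Sum>i<n. (X \<bullet> e i) * (e i \<bullet> e j)) = (\<Sum>i<n. if i = j then X \<bullet> e j else 0)"
      using ee j by (intro sum.cong) auto
    then show ?thesis
      unfolding r_def using j by (simp add: inner_diff_left inner_sum_left)
  qed
  have e0: "e i \<noteq> 0" if "i < n" for i using ee[OF that that] by auto
  have inj: "inj_on e {..<n}"
    using ee by (intro inj_onI) (metis lessThan_iff zero_neq_one)
  let ?B = "insert r (insert x (e ` {..<n}))"
  have x_notin: "x \<notin> e ` {..<n}"
  proof
    assume "x \<in> e ` {..<n}"
    then obtain i where "i < n" "x = e i" by auto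
    then show False using ex[of i] x(2) by simp
  qed
  have r_notin: "r \<notin> insert x (e ` {..<n})"
  proof
    assume "r \<in> insert x (e ` {..<n})"
    then have "r \<bullet> r = 0" using rx re by (metis imageE insertE lessThan_iff)
    then show False using r0 by simp
  qed
  have "pairwise orthogonal ?B"
    unfolding pairwise_insert
    using rx re ex ee by (auto simp: orthogonal_def inner_commute pairwise_def)
  moreover have "0 \<notin> ?B" using r0 x(2) e0 by auto
  ultimately have "independent ?B" by (rule pairwise_orthogonal_independent)
  then have "card ?B \<le> DIM('a)" by (rule independent_card_le)
  moreover have "card ?B = Suc (Suc n)"
    using x_notin r_notin card_image[OF inj] by simp
  ultimately show False using assms(2) by simp
qed

lemma oframe_parseval:
  fixes x :: "'a::euclidean_space"
  assumes "oframe n x e" "DIM('a) = Suc n" "X \<bullet> x = 0"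
  shows "X \<bullet> Y = (\<Sum>i<n. (X \<bullet> e i) * (Y \<bullet> e i))"
proof -
  have "X \<bullet> Y = (\<Sum>i<n. (X \<bullet> e i) *\<^sub>R e i) \<bullet> Y"
    using oframe_expansion[OF assms] by simp
  then show ?thesis by (simp add: inner_sum_left inner_sum_right inner_commute)
qed

lemma oframe_bilinear:
  fixes x :: "'a::euclidean_space"
  assumes "oframe n x e" "DIM('a) = Suc n" "bilinear h"
    and "\<And>i j. i < n \<Longrightarrow> j < n \<Longrightarrow> h (e i) (e j) = (if i = j then lam i else 0)"
    and "X \<bullet> x = 0" "Y \<bullet> x = 0"
  shows "h X Y = (\<Sum>i<n. lam i * ((X \<bullet> e i) * (Y \<bullet> e i)))"
proof -
  have "h X Y = h (\<Sum>i<n. (X \<bullet> e i) *\<^sub>R e i) (\<Sum>j<n. (Y \<bullet> e j) *\<^sub>R e j)"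
    using oframe_expansion[OF assms(1,2,5)] oframe_expansion[OF assms(1,2,6)] by simp
  also have "\<dots> = (\<Sum>(i,j)\<in>{..<n} \<times> {..<n}. h ((X \<bullet> e i) *\<^sub>R e i) ((Y \<bullet> e j) *\<^sub>R e j))"
    by (rule bilinear_sum[OF assms(3)])
  also have "\<dots> = (\<Sum>i<n. \<Sum>j<n. h ((X \<bullet> e i) *\<^sub>R e i) ((Y \<bullet> e j) *\<^sub>R e j))"
    by (simp add: sum.cartesian_product)
  also have "\<dots> = (\<Sum>i<n. \<Sum>j<n. if j = i then lam i * ((X \<bullet> e i) * (Y \<bullet> e i)) else 0)"
    using assms(4) by (intro sum.cong refl)
      (auto simp: bilinear_lmul[OF assms(3)] bilinear_rmul[OF assms(3)])
  also have "\<dots> = (\<Sum>i<n. lam i * ((X \<bullet> e i) * (Y \<bullet> e i)))"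
    by (intro sum.cong refl) (simp add: sum.delta)
  finally show ?thesis .
qed

text \<open>Rotation by the angle \<open>arctan t\<close> in the plane of \<open>x\<close> and
  \<open>e k\<close>, which fixes the other frame vectors.\<close>

lemma oframe_rotate:
  fixes x :: "'a::euclidean_space"
  assumes "oframe n x e" "k < n"
  defines "r \<equiv> \<lambda>t::real. sqrt (1 + t\<^sup>2)"
  shows "oframe n ((x + t *\<^sub>R e k) /\<^sub>R r t) (e(k := (e k - t *\<^sub>R x) /\<^sub>R r t))"
    and "norm (x + t *\<^sub>R e k) = r t"
proof -
  have xx: "x \<bullet> x = 1" and ex: "\<And>i. i < n \<Longrightarrow> e i \<bullet> x = 0" "\<And>i. i < n \<Longrightarrow> x \<bullet> e i = 0"
    and ee: "\<And>i j. i < n \<Longrightarrow> j < n \<Longrightarrow> e i \<bullet> e j = (if i = j then 1 else 0)"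
    using assms(1) by (auto simp: oframe_def dot_square_norm inner_commute)
  have r: "r t > 0" "r t * r t = 1 + t * t"
    by (simp_all add: r_def add_pos_nonneg power2_eq_square)
  have "(x + t *\<^sub>R e k) \<bullet> (x + t *\<^sub>R e k) = 1 + t * t"
    using xx ex ee assms(2) by (simp add: inner_add_left inner_add_right)
  then show nrm: "norm (x + t *\<^sub>R e k) = r t"
    by (simp add: norm_eq_sqrt_inner r_def power2_eq_square)
  have nu: "(e k - t *\<^sub>R x) \<bullet> (e k - t *\<^sub>R x) = r t * r t"
    using xx ex ee assms(2) r by (simp add: inner_diff_left inner_diff_right)
  have rr: "inverse (r t) * (inverse (r t) * (r t * r t)) = 1"
    using r(1) by (simp add: field_simps)
  have nu_x: "(e k - t *\<^sub>R x) \<bullet> (x + t *\<^sub>R e k) = 0"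
    using xx ex ee assms(2) by (simp add: inner_diff_left inner_add_right)
  show "oframe n ((x + t *\<^sub>R e k) /\<^sub>R r t) (e(k := (e k - t *\<^sub>R x) /\<^sub>R r t))"
    unfolding oframe_def
  proof (intro conjI allI impI)
    show "norm ((x + t *\<^sub>R e k) /\<^sub>R r t) = 1" using nrm r(1) by simp
  next
    fix i assume "i < n"
    then show "(e(k := (e k - t *\<^sub>R x) /\<^sub>R r t)) i \<bullet> ((x + t *\<^sub>R e k) /\<^sub>R r t) = 0"
      using nu_x ex ee assms(2) by (cases "i = k") (simp, auto simp: inner_add_right)
  next
    fix i j assume "i < n" "j < n"
    then show "(e(k := (e k - t *\<^sub>R x) /\<^sub>R r t)) i \<bullet> (e(k := (e k - t *\<^sub>R x) /\<^sub>R r t)) j = (if i = j then 1 else 0)"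
      using nu rr ex ee assms(2)
      by (cases "i = k \<and> j = k") (simp, auto simp: inner_diff_left inner_diff_right)
  qed
qed

text \<open>The Hessian is homogeneous of degree -1, which gives one factor \<open>r t\<close>. For
  \<open>i = k\<close> the rotated vector is \<open>r t *\<^sub>R e k\<close> up to a radial part,
  which gives two more. The entry in the moving frame thus becomes an explicit factor times a
  derivative in fixed directions.\<close>

lemma D2_hom1_rotate:
  fixes x :: "'a::euclidean_space"
  assumes "oframe n x e" "k < n" "i < n" "Ck 2 (- {0}) (hom1 u)"
  defines "r \<equiv> \<lambda>t::real. sqrt (1 + t\<^sup>2)"
  defines "e' \<equiv> \<lambda>t. e(k := (e k - t *\<^sub>R x) /\<^sub>R r t)"
  shows "D2 (hom1 u) ((x + t *\<^sub>R e k) /\<^sub>R r t) (e' t i) (e' t i)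
    = (if i = k then r t * (r t * r t) else r t) * D2 (hom1 u) (x + t *\<^sub>R e k) (e i) (e i)"
proof -
  define y where "y = x + t *\<^sub>R e k"
  have r: "r t > 0" "r t * r t = 1 + t * t"
    by (simp_all add: r_def add_pos_nonneg power2_eq_square)
  have y: "norm y = r t" unfolding y_def r_def by (rule oframe_rotate(2)[OF assms(1,2)])
  then have y0: "y \<in> - {0}" using r by auto
  have C: "Ck (Suc (Suc 0)) (- {0}) (hom1 u)" using assms(4) by (simp add: numeral_2_eq_2)
  note bil = D2_bilinear[OF open_punctured assms(4) y0]
  have sc: "D2 (hom1 u) (y /\<^sub>R r t) v w = r t * D2 (hom1 u) y v w" for v w
    using D2_hom1_scale[OF C, of "inverse (r t)" y v w] r y0 by (simp add: field_simps)
  show ?thesis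
  proof (cases "i = k")
    case False
    then show ?thesis using sc by (simp add: e'_def y_def)
  next
    case True
    have rad: "D2 (hom1 u) y y w = 0" "D2 (hom1 u) y w y = 0" for w
      using D2_hom1_radial[OF C, of y w] D2_commute[OF open_punctured assms(4) y0, of w y] y0 by auto
    \<comment> \<open>up to a multiple of the null direction y, the rotated vector is parallel to the original one\<close>
    have "(e k - t *\<^sub>R x) /\<^sub>R r t = r t *\<^sub>R e k - (t / r t) *\<^sub>R y"
    proof -
      have "e k - t *\<^sub>R x = (r t * r t) *\<^sub>R e k - t *\<^sub>R y"
        unfolding r(2) y_def by (simp add: scaleR_right_distrib scaleR_left_distrib)
      then show ?thesis
        using r(1) by (simp add: scaleR_diff_right divide_inverse mult.commute)
    qed
    then have "D2 (hom1 u) y (e' t i) (e' t i) = r t * (r t * D2 (hom1 u) y (e k) (e k))"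
      using True rad by (simp add: e'_def bilinear_lsub[OF bil] bilinear_rsub[OF bil]
          bilinear_lmul[OF bil] bilinear_rmul[OF bil])
    then show ?thesis using True sc[of "e' t i" "e' t i"] by (simp add: y_def)
  qed
qed

text \<open>Repeated exchange of adjacent derivatives. This takes the place of the commutation
  formulas on the sphere, with no curvature terms.\<close>

lemma D2_D2_commute:
  assumes "open S" "Ck 4 S f" "x \<in> S"
  shows "D2 (\<lambda>y. D2 f y v v) x w w = D2 (\<lambda>y. D2 f y w w) x v v"
proof -
  have C4: "Ck (Suc (Suc (Suc (Suc 0)))) S f" using assms(2) by (simp add: numeral_eq_Suc)
  have C2: "Ck 2 S f" by (rule Ck_le[OF assms(2)]) simp
  have D1_cong: "D1 g y a = D1 h y a" if "\<And>z. z \<in> S \<Longrightarrow> g z = h z" "y \<in> S" "Ck (Suc 0) S g" for g h y a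
    using D1_eqI[OF has_derivative_transform_within_open[OF Ck_has_derivative[OF assms(1) that(3,2)] assms(1) that(2), of h]]
      that(1) by metis
  have C1f: "Ck 2 S (\<lambda>z. D1 f z a)" for a
    using Ck_D1[OF assms(1) Ck_SucD[OF C4]] Ck_le[of "Suc (Suc (Suc 0))"] Ck_D1[OF assms(1) C4, of a]
    by (simp add: numeral_2_eq_2 del: Ck.simps)
  have C2f: "Ck 2 S (\<lambda>z. D2 f z a b)" for a b
    using Ck_D2[OF assms(1) C4] by (simp add: numeral_2_eq_2 del: Ck.simps)
  have C21: "Ck (Suc 0) S (\<lambda>z. D2 f z a b)" for a b
    by (rule Ck_le[OF C2f]) simp
  have D3: "D1 (\<lambda>y. D2 f y v v) z w = D1 (\<lambda>y. D2 f y w v) z v" if z: "z \<in> S" for z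
    using D2_commute[OF assms(1) C1f[of v] z, of w v] by (simp add: D2_D1)
  have C31: "Ck (Suc 0) S (\<lambda>z. D1 (\<lambda>y. D2 f y a b) z c)" for a b c
    by (rule Ck_D1[OF assms(1)]) (use C2f[of a b] in \<open>simp add: numeral_2_eq_2 del: Ck.simps\<close>)
  have "D2 (\<lambda>y. D2 f y v v) x w w = D1 (\<lambda>z. D1 (\<lambda>y. D2 f y v v) z w) x w"
    by (simp add: D2_D1)
  also have "\<dots> = D1 (\<lambda>z. D1 (\<lambda>y. D2 f y w v) z v) x w"
    by (rule D1_cong[OF D3 assms(3) C31])
  also have "\<dots> = D1 (\<lambda>z. D1 (\<lambda>y. D2 f y w v) z w) x v"
    using D2_commute[OF assms(1) C2f[of w v] assms(3), of w v] by (simp add: D2_D1)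
  also have "\<dots> = D1 (\<lambda>z. D1 (\<lambda>y. D2 f y v w) z w) x v"
    using D2_commute[OF assms(1) C2] by (intro D1_cong[OF _ assms(3) C31] D1_cong[OF _ _ C21]) auto
  also have "\<dots> = D1 (\<lambda>z. D1 (\<lambda>y. D2 f y w w) z v) x v"
    using D2_commute[OF assms(1) C1f[of w], of _ w v] by (intro D1_cong[OF _ assms(3) C31]) (simp add: D2_D1)
  finally show ?thesis by (simp add: D2_D1)
qed

text \<open>For \<open>i = k\<close> the function has a maximum at 0. For
  \<open>i \<noteq> k\<close> its second derivative is \<open>lam i\<close> plus a fourth derivative
  of the extension, \<open>lam i\<close> being the \<open>i\<close>-th diagonal entry at
  \<open>x\<close>. By commutation the fourth derivative is that of the \<open>k\<close>-th entry in
  direction \<open>e i\<close>, which is at most \<open>- M\<close>; and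
  \<open>lam i \<le> M\<close>.\<close>

lemma max_eigenvalue_second_derivative:
  fixes x :: "'a::euclidean_space"
  assumes "oframe n x e" "k < n" "i < n" "Ck 4 (- {0}) (hom1 u)"
    and "\<And>y X. norm y = 1 \<Longrightarrow> X \<bullet> y = 0 \<Longrightarrow> D2 (hom1 u) y X X \<le> D2 (hom1 u) x (e k) (e k) * (X \<bullet> X)"
  shows "\<exists>a b. deriv2 (\<lambda>t. (if i = k then sqrt (1 + t\<^sup>2) * (sqrt (1 + t\<^sup>2) * sqrt (1 + t\<^sup>2)) else sqrt (1 + t\<^sup>2))
      * D2 (hom1 u) (x + t *\<^sub>R e k) (e i) (e i)) a b \<and> b \<le> 0"
proof -
  let ?U = "hom1 u" and ?r = "\<lambda>t::real. sqrt (1 + t\<^sup>2)"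
  have x: "x \<in> - {0}" using assms(1) by (auto simp: oframe_def)
  have C2: "Ck 2 (- {0}) ?U" by (rule Ck_le[OF assms(4)]) simp
  have C22: "Ck 2 (- {0}) (\<lambda>y. D2 ?U y a b)" for a b
    using Ck_D2[OF open_punctured, of 2 ?U] assms(4) by (simp add: numeral_eq_Suc del: Ck.simps)
  have r3: "deriv2 (\<lambda>t. ?r t * (?r t * ?r t)) 0 3"
    using deriv2_mult[OF deriv2_sqrt deriv2_mult[OF deriv2_sqrt deriv2_sqrt]] by simp
  have line: "deriv2 (\<lambda>t. D2 ?U (x + t *\<^sub>R w) v v) (D1 (\<lambda>y. D2 ?U y v v) x w) (D2 (\<lambda>y. D2 ?U y v v) x w w)" for v w
    by (rule deriv2_line[OF open_punctured C22 x])
  define M where "M = D2 ?U x (e k) (e k)"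
  \<comment> \<open>The frame rotates toward \<open>e j\<close>, while the entry observed is always
    the \<open>k\<close>-th one.\<close>
  have le_M: "(if m = j then ?r t * (?r t * ?r t) else ?r t) * D2 ?U (x + t *\<^sub>R e j) (e m) (e m) \<le> M"
    if "j < n" "m < n" "m = k" for j m t
  proof -
    let ?e = "e(j := (e j - t *\<^sub>R x) /\<^sub>R ?r t)"
    have fr: "oframe n ((x + t *\<^sub>R e j) /\<^sub>R ?r t) ?e"
      by (rule oframe_rotate(1)[OF assms(1) that(1)])
    have "D2 ?U ((x + t *\<^sub>R e j) /\<^sub>R ?r t) (?e m) (?e m) \<le> M * (?e m \<bullet> ?e m)"
      unfolding M_def using fr that(2) by (intro assms(5)) (auto simp: oframe_def)
    also have "?e m \<bullet> ?e m = 1" using fr that(2) by (auto simp: oframe_def)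
    finally show ?thesis
      using D2_hom1_rotate[OF assms(1) that(1,2) C2, of t] by simp
  qed
  show ?thesis
  proof (cases "i = k")
    case True
    have d: "deriv2 (\<lambda>t. ?r t * (?r t * ?r t) * D2 ?U (x + t *\<^sub>R e k) (e k) (e k))
        (D1 (\<lambda>y. D2 ?U y (e k) (e k)) x (e k)) (3 * M + D2 (\<lambda>y. D2 ?U y (e k) (e k)) x (e k) (e k))"
      using deriv2_mult[OF r3 line[of "e k" "e k"]] by (simp add: M_def)
    moreover have "3 * M + D2 (\<lambda>y. D2 ?U y (e k) (e k)) x (e k) (e k) \<le> 0"
    proof (rule deriv2_local_max[OF d], rule always_eventually, intro allI)
      fix t show "?r t * (?r t * ?r t) * D2 ?U (x + t *\<^sub>R e k) (e k) (e k)
        \<le> ?r 0 * (?r 0 * ?r 0) * D2 ?U (x + 0 *\<^sub>R e k) (e k) (e k)"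
        using le_M[OF assms(2,2) refl, of t] by (simp add: M_def)
    qed
    ultimately show ?thesis using True by auto
  next
    case False
    \<comment> \<open>The directions are exchanged, moving toward \<open>e i\<close> and observing
      the entry along \<open>e k\<close>, because only that entry is known to be maximal at
      \<open>t = 0\<close>.\<close>
    have d: "deriv2 (\<lambda>t. ?r t * D2 ?U (x + t *\<^sub>R e i) (e k) (e k))
        (D1 (\<lambda>y. D2 ?U y (e k) (e k)) x (e i)) (M + D2 (\<lambda>y. D2 ?U y (e k) (e k)) x (e i) (e i))"
      using deriv2_mult[OF deriv2_sqrt line[where v = "e k" and w = "e i"]] by (simp add: M_def)
    have neg: "M + D2 (\<lambda>y. D2 ?U y (e k) (e k)) x (e i) (e i) \<le> 0"
    proof (rule deriv2_local_max[OF d], rule always_eventually, intro allI)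
      fix t show "?r t * D2 ?U (x + t *\<^sub>R e i) (e k) (e k) \<le> ?r 0 * D2 ?U (x + 0 *\<^sub>R e i) (e k) (e k)"
        using le_M[OF assms(3,2) refl, of t] False by (simp add: M_def)
    qed
    have d': "deriv2 (\<lambda>t. ?r t * D2 ?U (x + t *\<^sub>R e k) (e i) (e i))
        (D1 (\<lambda>y. D2 ?U y (e i) (e i)) x (e k)) (D2 ?U x (e i) (e i) + D2 (\<lambda>y. D2 ?U y (e i) (e i)) x (e k) (e k))"
      using deriv2_mult[OF deriv2_sqrt line[where v = "e i" and w = "e k"]] by simp
    have "D2 ?U x (e i) (e i) \<le> M"
      using assms(5)[of x "e i"] assms(1,3) by (auto simp: oframe_def M_def)
    moreover have "D2 (\<lambda>y. D2 ?U y (e i) (e i)) x (e k) (e k) = D2 (\<lambda>y. D2 ?U y (e k) (e k)) x (e i) (e i)"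
      by (rule D2_D2_commute[OF open_punctured assms(4) x])
    ultimately have "D2 ?U x (e i) (e i) + D2 (\<lambda>y. D2 ?U y (e i) (e i)) x (e k) (e k) \<le> 0"
      using neg by linarith
    then show ?thesis using False d' by auto
  qed
qed

section \<open>The maximum principle\<close>

lemma diag_frame_hom1:
  assumes "Ck_sphere 2 u" "norm x = 1"
    and "diag_frame n x (\<lambda>X Y. shess u x X Y + u x * (X \<bullet> Y)) e lam"
  shows "oframe n x e"
    and "\<And>i j. i < n \<Longrightarrow> j < n \<Longrightarrow> D2 (hom1 u) x (e i) (e j) = (if i = j then lam i else 0)"
proof -
  show "oframe n x e"
    using assms by (auto simp: oframe_def diag_frame_def)
  fix i j assume ij: "i < n" "j < n"
  then have "D2 (hom1 u) x (e i) (e j) = shess u x (e i) (e j) + u x * (e i \<bullet> e j)"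
    using assms by (intro D2_hom1_tangent) (auto simp: diag_frame_def)
  then show "D2 (hom1 u) x (e i) (e j) = (if i = j then lam i else 0)"
    using assms(3) ij unfolding diag_frame_def by metis
qed

lemma D2_ext0:
  assumes "Ck_sphere 2 u" "norm x = 1"
  shows "D2 (ext0 u) x X Y = shess u x X Y"
proof -
  have C: "Ck (Suc (Suc 0)) (- {0}) (ext0 u)" using assms(1) by (simp add: Ck_sphere_def numeral_2_eq_2)
  have "D1 (ext0 u) x x = 0"
    using assms(2) by (intro D1_radial_zero[OF _ C]) (auto simp: ext0_scale)
  then show ?thesis by (simp add: shess_def)
qed

text \<open>Compactness of the bundle of unit tangent vectors, which \<open>x0\<close> and
  \<open>X0\<close> show to be nonempty.\<close>

lemma hessian_max_attained:
  fixes f :: "'a::euclidean_space \<Rightarrow> real" and x0 X0 :: 'a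
  assumes "Ck 2 (- {0}) f" "norm x0 = 1" "norm X0 = 1" "X0 \<bullet> x0 = 0"
  obtains x X where "norm x = 1" "norm X = 1" "X \<bullet> x = 0"
    and "\<And>y Y. norm y = 1 \<Longrightarrow> Y \<bullet> y = 0 \<Longrightarrow> D2 f y Y Y \<le> D2 f x X X * (Y \<bullet> Y)"
proof -
  define T where "T = (sphere (0::'a) 1 \<times> sphere (0::'a) 1) \<inter> {p. snd p \<bullet> fst p = 0}"
  have "compact T"
    unfolding T_def by (intro compact_Int_closed compact_Times compact_sphere closed_Collect_eq continuous_intros)
  moreover have "(x0, X0) \<in> T" using assms(2-4) by (simp add: T_def)
  then have "T \<noteq> {}" by blast
  moreover have "continuous_on T (\<lambda>p. D2 f (fst p) (snd p) (snd p))"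
  proof -
    \<comment> \<open>Continuity of \<open>D2 f\<close> in the base point is available for fixed
      directions only; expanding in the basis gives joint continuity.\<close>
    have eq: "D2 f y Y Y = (\<Sum>(b,c)\<in>Basis \<times> Basis. (Y \<bullet> b) * ((Y \<bullet> c) * D2 f y b c))" if "y \<in> - {0}" for y Y
    proof -
      note bil = D2_bilinear[OF open_punctured assms(1) that]
      have "D2 f y Y Y = D2 f y (\<Sum>b\<in>Basis. (Y \<bullet> b) *\<^sub>R b) (\<Sum>b\<in>Basis. (Y \<bullet> b) *\<^sub>R b)"
        by (simp add: euclidean_representation)
      also have "\<dots> = (\<Sum>(b,c)\<in>Basis \<times> Basis. D2 f y ((Y \<bullet> b) *\<^sub>R b) ((Y \<bullet> c) *\<^sub>R c))"
        by (rule bilinear_sum[OF bil])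
      finally show ?thesis
        by (simp add: bilinear_lmul[OF bil] bilinear_rmul[OF bil] mult.left_commute)
    qed
    have cont: "continuous_on T (\<lambda>p. D2 f (fst p) b c)" for b c
    proof (rule continuous_on_compose2[where g = "\<lambda>y. D2 f y b c" and t = "- {0}"])
      show "continuous_on (- {0}) (\<lambda>y. D2 f y b c)"
        using assms(1) by (intro Ck_continuous_on[of 0] Ck_D2[OF open_punctured]) (simp add: numeral_2_eq_2)
    qed (auto simp: T_def intro!: continuous_intros)
    have "continuous_on T (\<lambda>p. \<Sum>(b,c)\<in>Basis \<times> Basis. (snd p \<bullet> b) * ((snd p \<bullet> c) * D2 f (fst p) b c))"
      unfolding case_prod_beta by (intro continuous_intros cont)
    then show ?thesis
    proof (rule continuous_on_eq)
      fix p assume "p \<in> T"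
      then have "fst p \<in> - {0}" by (auto simp: T_def)
      then show "(\<Sum>(b,c)\<in>Basis \<times> Basis. (snd p \<bullet> b) * ((snd p \<bullet> c) * D2 f (fst p) b c)) = D2 f (fst p) (snd p) (snd p)"
        by (simp only: eq)
    qed
  qed
  ultimately obtain q where q: "q \<in> T" "\<And>p. p \<in> T \<Longrightarrow> D2 f (fst p) (snd p) (snd p) \<le> D2 f (fst q) (snd q) (snd q)"
    using continuous_attains_sup[of T "\<lambda>p. D2 f (fst p) (snd p) (snd p)"] by blast
  define M where "M = D2 f (fst q) (snd q) (snd q)"
  have "D2 f y Y Y \<le> M * (Y \<bullet> Y)" if y: "norm y = 1" "Y \<bullet> y = 0" for y Y
  proof -
    have "y \<in> - {0}" using y by auto
    note bil = D2_bilinear[OF open_punctured assms(1) this]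
    show ?thesis
    proof (cases "Y = 0")
      case True
      then show ?thesis by (simp add: bilinear_lzero[OF bil])
    next
      case False
      have "(y, Y /\<^sub>R norm Y) \<in> T" using y False by (auto simp: T_def)
      from q(2)[OF this] have "inverse (norm Y) * (inverse (norm Y) * D2 f y Y Y) \<le> M"
        by (simp add: M_def bilinear_lmul[OF bil] bilinear_rmul[OF bil])
      then have "(norm Y * norm Y) * (inverse (norm Y) * (inverse (norm Y) * D2 f y Y Y)) \<le> (norm Y * norm Y) * M"
        by (intro mult_left_mono) auto
      also have "(norm Y * norm Y) * (inverse (norm Y) * (inverse (norm Y) * D2 f y Y Y)) = D2 f y Y Y"
        using False by (simp add: field_simps)
      finally show ?thesis by (simp only: dot_square_norm power2_eq_square mult.commute)
    qed
  qed
  then show ?thesis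
    using q(1) by (intro that[of "fst q" "snd q"]) (auto simp: T_def M_def)
qed

text \<open>One solution, with the equation already transferred to the extension
  \<open>hom1 u\<close>. The bounds on the data and the condition on \<open>p\<close> enter as
  premises of the single estimates, so that the constants appear explicitly.\<close>

locale hessian_quotient_solution =
  fixes u \<phi> :: "'a::euclidean_space \<Rightarrow> real" and n P k l :: nat and p :: real
  assumes dim: "DIM('a) = Suc n" and n_pos: "0 < n"
    and P: "1 \<le> P" "P \<le> n"
    and kl: "l < k" "k \<le> n choose P"
    and u_C4: "Ck_sphere 4 u" and phi_C2: "Ck_sphere 2 \<phi>"
    and u_pos: "norm x = 1 \<Longrightarrow> u x > 0" and phi_pos: "norm x = 1 \<Longrightarrow> \<phi> x > 0"
    and equation: "norm x = 1 \<Longrightarrow> \<exists>e lam. oframe n x e \<and>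
        (\<forall>i<n. \<forall>j<n. D2 (hom1 u) x (e i) (e j) = (if i = j then lam i else 0)) \<and>
        in_Gamma k (multi_idx n P) (Lam lam) \<and>
        sigma k (multi_idx n P) (Lam lam) / sigma l (multi_idx n P) (Lam lam) = u x powr (p - 1) * \<phi> x"
begin

lemma u_C2: "Ck_sphere 2 u"
  using u_C4 unfolding Ck_sphere_def by (rule Ck_le) simp

lemma hom1_C4: "Ck 4 (- {0}) (hom1 u)"
  by (rule Ck_hom1[OF u_C4])

lemma hom1_C2: "Ck 2 (- {0}) (hom1 u)"
  by (rule Ck_hom1[OF u_C2])

definition principal_frame :: "'a \<Rightarrow> (nat \<Rightarrow> 'a) \<Rightarrow> (nat \<Rightarrow> real) \<Rightarrow> bool" where
  "principal_frame x e lam \<longleftrightarrow> oframe n x e \<and>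
    (\<forall>i<n. \<forall>j<n. D2 (hom1 u) x (e i) (e j) = (if i = j then lam i else 0)) \<and>
    in_Gamma k (multi_idx n P) (Lam lam) \<and>
    sigma k (multi_idx n P) (Lam lam) / sigma l (multi_idx n P) (Lam lam) = u x powr (p - 1) * \<phi> x"

lemma principal_frame_exists: "norm x = 1 \<Longrightarrow> \<exists>e lam. principal_frame x e lam"
  using equation by (simp add: principal_frame_def)

lemma principal_frameD:
  assumes "principal_frame x e lam"
  shows "oframe n x e"
    and "\<And>i j. i < n \<Longrightarrow> j < n \<Longrightarrow> D2 (hom1 u) x (e i) (e j) = (if i = j then lam i else 0)"
    and "in_Gamma k (multi_idx n P) (Lam lam)"
    and "(\<Prod>j\<in>{l..<k}. sigma_quot j (multi_idx n P) (Lam lam)) = u x powr (p - 1) * \<phi> x"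
    and "\<And>X Y. X \<bullet> x = 0 \<Longrightarrow> Y \<bullet> x = 0 \<Longrightarrow>
        D2 (hom1 u) x X Y = (\<Sum>i<n. lam i * ((X \<bullet> e i) * (Y \<bullet> e i)))"
proof -
  show 1: "oframe n x e"
    and 2: "\<And>i j. i < n \<Longrightarrow> j < n \<Longrightarrow> D2 (hom1 u) x (e i) (e j) = (if i = j then lam i else 0)"
    and 3: "in_Gamma k (multi_idx n P) (Lam lam)"
    using assms by (auto simp: principal_frame_def)
  show "(\<Prod>j\<in>{l..<k}. sigma_quot j (multi_idx n P) (Lam lam)) = u x powr (p - 1) * \<phi> x"
    using prod_sigma_quot[OF finite_multi_idx 3, of l] kl assms by (simp add: principal_frame_def)
  have "x \<in> - {0}" using 1 by (auto simp: oframe_def)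
  then have "bilinear (D2 (hom1 u) x)" by (rule D2_bilinear[OF open_punctured hom1_C2])
  then show "D2 (hom1 u) x X Y = (\<Sum>i<n. lam i * ((X \<bullet> e i) * (Y \<bullet> e i)))"
    if "X \<bullet> x = 0" "Y \<bullet> x = 0" for X Y
    using oframe_bilinear[OF 1 dim _ 2 that] by blast
qed

text \<open>At a minimum \<open>z\<close> the Hessian of \<open>u\<close> is nonnegative, so all
  eigenvalues are at least \<open>u z\<close>. Each of the \<open>k - l\<close> quotients is then at
  least \<open>u z / 2\<close> times its value at the all-ones vector, whence
  \<open>u z ^ (k - l) * K / 2 ^ (k - l) \<le> u z powr (p - 1) * B\<close>, which is solved for
  \<open>u z\<close>.\<close>

lemma u_lower_bound:
  assumes "p > real (k + 1) - real l" "\<And>x. norm x = 1 \<Longrightarrow> \<phi> x \<le> B"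
  defines "K \<equiv> (\<Prod>j\<in>{l..<k}. sigma_quot j (multi_idx n P) (Lam (\<lambda>_. 1)))"
  assumes "norm x = 1"
  shows "(K / (2 ^ (k - l) * B)) powr (1 / (p - 1 - real (k - l))) \<le> u x" and "K > 0"
proof -
  have "compact (sphere (0::'a) 1)" "sphere (0::'a) 1 \<noteq> {}" by (simp_all add: sphere_eq_empty)
  moreover have "continuous_on (sphere 0 1) (ext0 u)"
    using u_C4 unfolding Ck_sphere_def
    by (intro continuous_on_subset[OF Ck_continuous_on]) auto
  ultimately obtain z where z: "z \<in> sphere 0 1" "\<And>y. y \<in> sphere 0 1 \<Longrightarrow> ext0 u z \<le> ext0 u y"
    using continuous_attains_inf[of "sphere 0 1" "ext0 u"] by blast
  have z1: "norm z = 1" "z \<in> - {0}" using z by auto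
  have ext_ge: "ext0 u y \<ge> u z" if "y \<noteq> 0" for y
    using z(2)[of "y /\<^sub>R norm y"] ext0_scale[of "inverse (norm y)" u y] z1 that by (simp add: ext0_unit)
  obtain e lam where "principal_frame z e lam" using principal_frame_exists[OF z1(1)] by blast
  note f = principal_frameD[OF this]
  have lam: "lam i \<ge> u z" if i: "i < n" for i
  proof -
    have e: "e i \<bullet> z = 0" "e i \<bullet> e i = 1" using f(1) i by (auto simp: oframe_def)
    have "deriv2 (\<lambda>t. ext0 u (z + t *\<^sub>R e i)) (D1 (ext0 u) z (e i)) (D2 (ext0 u) z (e i) (e i))"
      using u_C2 z1 unfolding Ck_sphere_def by (intro deriv2_line[OF open_punctured]) auto
    from deriv2_cmult[OF this, of "-1"]
    have "(-1) * D2 (ext0 u) z (e i) (e i) \<le> 0"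
    proof (rule deriv2_local_max, intro always_eventually allI)
      fix t
      have "norm (z + t *\<^sub>R e i) = sqrt (1 + t\<^sup>2)" by (rule oframe_rotate(2)[OF f(1) i])
      then have "z + t *\<^sub>R e i \<noteq> 0" by (smt (verit) norm_zero real_sqrt_eq_zero_cancel_iff zero_le_power2)
      then show "-1 * ext0 u (z + t *\<^sub>R e i) \<le> -1 * ext0 u (z + 0 *\<^sub>R e i)"
        using ext_ge z1 by (simp add: ext0_unit)
    qed
    then have "shess u z (e i) (e i) \<ge> 0" using D2_ext0[OF u_C2 z1(1)] by simp
    then show ?thesis
      using D2_hom1_tangent[OF u_C2 z1(1) e(1) e(1)] f(2)[OF i i] e by simp
  qed
  have uz: "u z > 0" by (rule u_pos[OF z1(1)])
  have s_pos: "sigma_quot j (multi_idx n P) (Lam (\<lambda>_. 1)) > 0" if "j < k" for j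
  proof -
    have *: "in_Gamma (Suc j) (multi_idx n P) (Lam (\<lambda>_. 1))"
      using P kl that by (intro in_Gamma_Lam_pos) auto
    show ?thesis unfolding sigma_quot_def using in_Gamma_pos[OF * finite_multi_idx] by simp
  qed
  show K: "K > 0" unfolding K_def using s_pos by (intro prod_pos) auto
  have B: "B > 0" using phi_pos[OF z1(1)] assms(2)[OF z1(1)] by linarith
  have "(u z / 2) ^ (k - l) * K = (\<Prod>j\<in>{l..<k}. u z / 2 * sigma_quot j (multi_idx n P) (Lam (\<lambda>_. 1)))"
    unfolding K_def prod.distrib by simp
  also have "\<dots> \<le> (\<Prod>j\<in>{l..<k}. sigma_quot j (multi_idx n P) (Lam lam))"
    using s_pos uz lam P kl by (intro prod_mono conjI sigma_quot_Lam_lower_bound) (auto simp: less_imp_le)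
  also have "\<dots> \<le> u z powr (p - 1) * B"
    unfolding f(4) using assms(2)[OF z1(1)] by (intro mult_left_mono) auto
  finally have "u z ^ (k - l) * (K / (2 ^ (k - l) * B)) \<le> u z powr (p - 1)"
    using B by (simp add: field_simps power_divide)
  also have "u z powr (p - 1) = u z ^ (k - l) * u z powr (p - 1 - real (k - l))"
    using uz by (simp add: powr_realpow[symmetric] powr_add[symmetric])
  finally have le: "K / (2 ^ (k - l) * B) \<le> u z powr (p - 1 - real (k - l))"
    using uz by (simp only: mult_le_cancel_left_pos zero_less_power)
  have \<beta>: "p - 1 - real (k - l) > 0" using assms(1) kl by (simp add: of_nat_diff)
  have "(K / (2 ^ (k - l) * B)) powr (1 / (p - 1 - real (k - l)))
      \<le> (u z powr (p - 1 - real (k - l))) powr (1 / (p - 1 - real (k - l)))"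
    using le \<beta> K B by (intro powr_mono2) auto
  also have "\<dots> = u z" using \<beta> uz by (simp add: powr_powr)
  also have "\<dots> \<le> u x" using ext_ge[of x] assms(4) by (simp add: ext0_unit) (use assms(4) in force)
  finally show "(K / (2 ^ (k - l) * B)) powr (1 / (p - 1 - real (k - l))) \<le> u x" .
qed

text \<open>At a maximum of the largest eigenvalue, each supergradient bound for the quotients along the
  frame rotating with x + t e has nonpositive second derivative; taking logarithms of the equation
  then forces the logarithm of its right-hand side to have nonpositive second derivative.\<close>

lemma rhs_log_second_derivative:
  assumes "oframe n x e" "i0 < n"
    and e: "\<And>i j. i < n \<Longrightarrow> j < n \<Longrightarrow> D2 (hom1 u) x (e i) (e j) = (if i = j then lam i else 0)"
    and \<Gamma>: "in_Gamma k (multi_idx n P) (Lam lam)"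
    and eq: "(\<Prod>j\<in>{l..<k}. sigma_quot j (multi_idx n P) (Lam lam)) = u x powr (p - 1) * \<phi> x"
    and max: "\<And>y X. norm y = 1 \<Longrightarrow> X \<bullet> y = 0 \<Longrightarrow> D2 (hom1 u) y X X \<le> lam i0 * (X \<bullet> X)"
  shows "(p - 1) * (shess u x (e i0) (e i0) / u x - (sgrad u x (e i0) / u x)\<^sup>2)
    + (shess \<phi> x (e i0) (e i0) / \<phi> x - (sgrad \<phi> x (e i0) / \<phi> x)\<^sup>2) \<le> 0"
proof -
  let ?A = "multi_idx n P" and ?r = "\<lambda>t::real. sqrt (1 + t\<^sup>2)"
  have x: "norm x = 1" "x \<in> - {0}" using assms(1) by (auto simp: oframe_def)
  \<comment> \<open>By \<open>D2_hom1_rotate\<close> these are the diagonal entries in the rotating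
    frame.\<close>
  define d where "d = (\<lambda>i t. (if i = i0 then ?r t * (?r t * ?r t) else ?r t) * D2 (hom1 u) (x + t *\<^sub>R e i0) (e i) (e i))"
  have d0: "d i 0 = lam i" if "i < n" for i using e[OF that that] by (simp add: d_def)
  have "\<exists>a b. deriv2 (d i) a b \<and> b \<le> 0" if "i < n" for i
    unfolding d_def using max e[OF assms(2,2)]
    by (intro max_eigenvalue_second_derivative[OF assms(1,2) that hom1_C4]) simp
  then obtain a b where ab: "\<And>i. i < n \<Longrightarrow> deriv2 (d i) (a i) (b i)" "\<And>i. i < n \<Longrightarrow> b i \<le> 0"
    by metis
  have "\<exists>c. (\<forall>i<n. c i \<ge> 0) \<and> (\<Sum>i<n. c i * lam i) = sigma_quot j ?A (Lam lam) \<and>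
      (\<forall>mu. in_Gamma (Suc j) ?A (Lam mu) \<longrightarrow> sigma_quot j ?A (Lam mu) \<le> (\<Sum>i<n. c i * mu i))" if "j < k" for j
    using Lam_supergradient[OF P(1), of j n lam] kl that in_Gamma_mono[OF \<Gamma>, of "Suc j"] by (metis Suc_leI le_trans)
  then obtain c where c: "\<And>j i. j < k \<Longrightarrow> i < n \<Longrightarrow> c j i \<ge> 0"
    "\<And>j. j < k \<Longrightarrow> (\<Sum>i<n. c j i * lam i) = sigma_quot j ?A (Lam lam)"
    "\<And>j mu. j < k \<Longrightarrow> in_Gamma (Suc j) ?A (Lam mu) \<Longrightarrow> sigma_quot j ?A (Lam mu) \<le> (\<Sum>i<n. c j i * mu i)"
    by metis
  \<comment> \<open>The supergradient coefficients are those at \<open>x\<close> for every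
    \<open>t\<close>, so \<open>L j\<close> is smooth near 0 whatever the eigenvalues do.\<close>
  define L where "L = (\<lambda>j t. \<Sum>i<n. c j i * d i t)"
  have L0: "L j 0 = sigma_quot j ?A (Lam lam)" if "j < k" for j
    using c(2)[OF that] d0 by (simp add: L_def)
  have sq_pos: "sigma_quot j ?A (Lam mu) > 0" if "j < k" "in_Gamma k ?A (Lam mu)" for j mu
    unfolding sigma_quot_def using in_Gamma_pos[OF that(2) finite_multi_idx] that(1) by simp
  define v where "v = (\<lambda>t. (p - 1) * ln (ext0 u (x + t *\<^sub>R e i0)) + ln (ext0 \<phi> (x + t *\<^sub>R e i0)))"
  \<comment> \<open>With equality at \<open>t = 0\<close>, this makes the difference of the two
    sides maximal there.\<close>
  have key: "v t \<le> (\<Sum>j\<in>{l..<k}. ln (L j t))" for t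
  proof -
    define y where "y = (x + t *\<^sub>R e i0) /\<^sub>R ?r t"
    define e' where "e' = e(i0 := (e i0 - t *\<^sub>R x) /\<^sub>R ?r t)"
    have r: "?r t > 0" by (simp add: add_pos_nonneg)
    have fr: "oframe n y e'"
      unfolding y_def e'_def by (rule oframe_rotate(1)[OF assms(1,2)])
    then have y: "norm y = 1" by (simp add: oframe_def)
    obtain f mu where "principal_frame y f mu" using principal_frame_exists[OF y] by blast
    note f = principal_frameD[OF this]
    \<comment> \<open>Squared entries of the orthogonal matrix between the rotated frame and a
      principal frame at the same point; Parseval in each frame makes it doubly stochastic.\<close>
    define Q where "Q = (\<lambda>i m. (e' i \<bullet> f m) * (e' i \<bullet> f m))"
    have d_eq: "d i t = (\<Sum>m<n. Q i m * mu m)" if i: "i < n" for i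
    proof -
      have "d i t = D2 (hom1 u) y (e' i) (e' i)"
        using D2_hom1_rotate[OF assms(1,2) i hom1_C2, of t] by (simp add: d_def y_def e'_def)
      also have "\<dots> = (\<Sum>m<n. mu m * ((e' i \<bullet> f m) * (e' i \<bullet> f m)))"
        using fr i by (intro f(5)) (auto simp: oframe_def)
      finally show ?thesis by (simp add: Q_def mult.commute)
    qed
    have L_ge: "sigma_quot j ?A (Lam mu) \<le> L j t" if j: "j < k" for j
    proof -
      have "sigma_quot j ?A (Lam mu) \<le> (\<Sum>i<n. c j i * (\<Sum>m<n. Q i m * mu m))"
      proof (rule sigma_quot_Lam_le_doubly_stochastic)
        show "in_Gamma (Suc j) ?A (Lam mu)" using in_Gamma_mono[OF f(3)] j by simp
        show "(\<Sum>m<n. Q i m) = 1" if "i < n" for i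
        proof -
          have "e' i \<bullet> y = 0" "e' i \<bullet> e' i = 1" using fr that by (auto simp: oframe_def)
          then show ?thesis using oframe_parseval[OF f(1) dim, of "e' i" "e' i"] by (simp add: Q_def)
        qed
        show "(\<Sum>i<n. Q i m) = 1" if "m < n" for m
        proof -
          have "f m \<bullet> y = 0" "f m \<bullet> f m = 1" using f(1) that by (auto simp: oframe_def)
          then show ?thesis using oframe_parseval[OF fr dim, of "f m" "f m"] by (simp add: Q_def inner_commute)
        qed
      qed (use c(3)[OF j] in \<open>auto simp: Q_def\<close>)
      then show ?thesis using d_eq by (simp add: L_def)
    qed
    have ext: "ext0 w (x + t *\<^sub>R e i0) = w y" for w :: "'a \<Rightarrow> real"
      using ext0_scale[of "inverse (?r t)" w "x + t *\<^sub>R e i0"] ext0_unit[OF y, of w] r by (simp add: y_def)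
    have "v t = ln (u y powr (p - 1) * \<phi> y)"
      using u_pos[OF y] phi_pos[OF y] by (simp add: v_def ext ln_mult ln_powr)
    also have "\<dots> = (\<Sum>j\<in>{l..<k}. ln (sigma_quot j ?A (Lam mu)))"
      unfolding f(4)[symmetric] using sq_pos f(3) by (intro ln_prod) (auto simp: less_imp_neq[symmetric])
    also have "\<dots> \<le> (\<Sum>j\<in>{l..<k}. ln (L j t))"
    proof (intro sum_mono)
      fix j assume "j \<in> {l..<k}"
      then have "j < k" by simp
      then show "ln (sigma_quot j ?A (Lam mu)) \<le> ln (L j t)"
        using L_ge[of j] sq_pos[OF _ f(3), of j] by (intro ln_mono) auto
    qed
    finally show ?thesis .
  qed
  have "v 0 = ln (u x powr (p - 1) * \<phi> x)"
    using u_pos[OF x(1)] phi_pos[OF x(1)] x by (simp add: v_def ext0_unit ln_mult ln_powr)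
  also have "\<dots> = (\<Sum>j\<in>{l..<k}. ln (L j 0))"
    unfolding eq[symmetric] using sq_pos[OF _ \<Gamma>] L0
    by (subst ln_prod) (auto simp: less_imp_neq[symmetric])
  finally have key0: "v 0 = (\<Sum>j\<in>{l..<k}. ln (L j 0))" .
  define La where "La = (\<lambda>j. \<Sum>i<n. c j i * a i)"
  define Lb where "Lb = (\<lambda>j. \<Sum>i<n. c j i * b i)"
  have Lpos: "L j 0 > 0" if "j < k" for j using L0[OF that] sq_pos[OF that \<Gamma>] by simp
  have Lb: "Lb j \<le> 0" if "j < k" for j
    unfolding Lb_def using c(1)[OF that] ab(2) by (intro sum_nonpos mult_nonneg_nonpos) auto
  have dL: "deriv2 (\<lambda>t. ln (L j t)) (La j / L j 0) (Lb j / L j 0 - (La j / L j 0)\<^sup>2)" if "j < k" for j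
    using Lpos[OF that] ab(1) unfolding L_def[abs_def] La_def Lb_def
    by (intro deriv2_ln deriv2_sum deriv2_cmult) auto
  have ext_line: "deriv2 (\<lambda>t. ln (ext0 w (x + t *\<^sub>R e i0))) (sgrad w x (e i0) / w x)
      (shess w x (e i0) (e i0) / w x - (sgrad w x (e i0) / w x)\<^sup>2)" if w: "Ck_sphere 2 w" "w x > 0" for w
  proof -
    have "deriv2 (\<lambda>t. ext0 w (x + t *\<^sub>R e i0)) (D1 (ext0 w) x (e i0)) (D2 (ext0 w) x (e i0) (e i0))"
      using w(1) x unfolding Ck_sphere_def by (intro deriv2_line[OF open_punctured]) auto
    from deriv2_ln[OF this] show ?thesis
      using w(2) x(1) D2_ext0[OF w(1) x(1)] by (simp add: ext0_unit sgrad_def)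
  qed
  let ?R = "(p - 1) * (shess u x (e i0) (e i0) / u x - (sgrad u x (e i0) / u x)\<^sup>2)
    + (shess \<phi> x (e i0) (e i0) / \<phi> x - (sgrad \<phi> x (e i0) / \<phi> x)\<^sup>2)"
  let ?S = "\<Sum>j\<in>{l..<k}. Lb j / L j 0 - (La j / L j 0)\<^sup>2"
  have "deriv2 (\<lambda>t. v t + (-1) * (\<Sum>j\<in>{l..<k}. ln (L j t)))
      (((p - 1) * (sgrad u x (e i0) / u x) + sgrad \<phi> x (e i0) / \<phi> x) + (-1) * (\<Sum>j\<in>{l..<k}. La j / L j 0))
      (?R + (-1) * ?S)"
    unfolding v_def using u_pos[OF x(1)] phi_pos[OF x(1)]
    by (intro deriv2_add deriv2_cmult deriv2_sum ext_line u_C2 phi_C2 dL) auto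
  then have "?R + (-1) * ?S \<le> 0"
  proof (rule deriv2_local_max, intro always_eventually allI)
    fix t show "v t + (-1) * (\<Sum>j\<in>{l..<k}. ln (L j t)) \<le> v 0 + (-1) * (\<Sum>j\<in>{l..<k}. ln (L j 0))"
      using key[of t] key0 by simp
  qed
  \<comment> \<open>Nonnegative coefficients and \<open>b i \<le> 0\<close> control the linear part,
    and concavity of the logarithm contributes the negative squares.\<close>
  moreover have "?S \<le> 0"
  proof (intro sum_nonpos)
    fix j assume "j \<in> {l..<k}"
    then have "Lb j / L j 0 \<le> 0" using Lb[of j] Lpos[of j] by (simp add: divide_nonpos_pos)
    then show "Lb j / L j 0 - (La j / L j 0)\<^sup>2 \<le> 0" using zero_le_power2[of "La j / L j 0"] by linarith
  qed
  ultimately show ?thesis by linarith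
qed

text \<open>At the maximum \<open>shess u\<close> in the maximal direction is
  \<open>M - u x\<close>, so the second-derivative inequality bounds
  \<open>(p - 1) * (M - u x) / u x\<close> by gradient and Hessian quotients of the data. Solving
  for \<open>M\<close> gives the stated constant.\<close>

lemma hessian_upper_bound:
  assumes "p > 1" "m > 0" "u0 > 0"
    and "\<And>x. norm x = 1 \<Longrightarrow> u0 \<le> u x \<and> u x \<le> A" "\<And>x. norm x = 1 \<Longrightarrow> m \<le> \<phi> x"
    and "\<And>x X. norm x = 1 \<Longrightarrow> X \<bullet> x = 0 \<Longrightarrow> \<bar>sgrad u x X\<bar> \<le> A * norm X"
    and "\<And>x X. norm x = 1 \<Longrightarrow> X \<bullet> x = 0 \<Longrightarrow> \<bar>sgrad \<phi> x X\<bar> \<le> B * norm X"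
    and "\<And>x X. norm x = 1 \<Longrightarrow> X \<bullet> x = 0 \<Longrightarrow> \<bar>shess \<phi> x X X\<bar> \<le> B * norm X * norm X"
    and "norm y = 1" "Y \<bullet> y = 0"
  shows "D2 (hom1 u) y Y Y \<le> A * (1 + (A / u0)\<^sup>2 + (B / m + (B / m)\<^sup>2) / (p - 1)) * (Y \<bullet> Y)"
proof -
  obtain e0 lam0 where "principal_frame y e0 lam0" using principal_frame_exists[OF assms(9)] by blast
  note e0 = principal_frameD[OF this]
  obtain x X where xX: "norm x = 1" "norm X = 1" "X \<bullet> x = 0"
    "\<And>y Y. norm y = 1 \<Longrightarrow> Y \<bullet> y = 0 \<Longrightarrow> D2 (hom1 u) y Y Y \<le> D2 (hom1 u) x X X * (Y \<bullet> Y)"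
    using hessian_max_attained[OF hom1_C2, of y "e0 0"] e0(1) n_pos by (auto simp: oframe_def norm_eq_1)
  obtain e lam where "principal_frame x e lam" using principal_frame_exists[OF xX(1)] by blast
  note f = principal_frameD[OF this]
  define M where "M = D2 (hom1 u) x X X"
  have ei: "e i \<bullet> x = 0" "e i \<bullet> e i = 1" if "i < n" for i using f(1) that by (auto simp: oframe_def)
  have lam_le: "lam i \<le> M" if "i < n" for i
    using xX(4)[OF xX(1) ei(1)[OF that]] f(2)[OF that that] ei(2)[OF that] by (simp add: M_def)
  \<comment> \<open>The maximizing direction need not belong to the principal frame at
    \<open>x\<close>. But \<open>M\<close> is an average of the \<open>lam i\<close> with weights
    \<open>(X \<bullet> e i)\<^sup>2\<close>, so some eigenvalue attains it.\<close>
  have "\<exists>i<n. M \<le> lam i"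
  proof (rule ccontr)
    assume "\<not> ?thesis"
    then have less: "lam i < M" if "i < n" for i using that by auto
    have par: "1 = (\<Sum>i<n. (X \<bullet> e i) * (X \<bullet> e i))"
      using oframe_parseval[OF f(1) dim xX(3), of X] xX(2) by (simp add: norm_eq_1)
    then obtain i where i: "i < n" "(X \<bullet> e i) * (X \<bullet> e i) \<noteq> 0"
      by (metis (no_types, lifting) lessThan_iff sum.neutral zero_neq_one)
    have "M = (\<Sum>i<n. lam i * ((X \<bullet> e i) * (X \<bullet> e i)))"
      unfolding M_def by (rule f(5)[OF xX(3,3)])
    also have "\<dots> < (\<Sum>i<n. M * ((X \<bullet> e i) * (X \<bullet> e i)))"
    proof (rule sum_strict_mono_ex1)
      show "\<forall>i\<in>{..<n}. lam i * ((X \<bullet> e i) * (X \<bullet> e i)) \<le> M * ((X \<bullet> e i) * (X \<bullet> e i))"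
        using lam_le by (auto intro!: mult_right_mono)
      show "\<exists>i\<in>{..<n}. lam i * ((X \<bullet> e i) * (X \<bullet> e i)) < M * ((X \<bullet> e i) * (X \<bullet> e i))"
        using i less by (intro bexI[of _ i] mult_strict_right_mono) (auto simp: zero_less_mult_iff linorder_neq_iff)
    qed simp
    also have "\<dots> = M" using par by (simp add: sum_distrib_left[symmetric])
    finally show False by simp
  qed
  then obtain i where i: "i < n" "lam i = M" using lam_le by (metis antisym)
  have "(p - 1) * (shess u x (e i) (e i) / u x - (sgrad u x (e i) / u x)\<^sup>2)
    + (shess \<phi> x (e i) (e i) / \<phi> x - (sgrad \<phi> x (e i) / \<phi> x)\<^sup>2) \<le> 0"
    using xX(4) i(2) by (intro rhs_log_second_derivative[OF f(1) i(1) f(2-4)]) (auto simp: M_def)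
  moreover have "shess u x (e i) (e i) = M - u x"
    using D2_hom1_tangent[OF u_C2 xX(1) ei(1)[OF i(1)] ei(1)[OF i(1)]] f(2)[OF i(1) i(1)] ei(2)[OF i(1)] i(2) by simp
  ultimately have main: "(p - 1) * ((M - u x) / u x - (sgrad u x (e i) / u x)\<^sup>2)
    + (shess \<phi> x (e i) (e i) / \<phi> x - (sgrad \<phi> x (e i) / \<phi> x)\<^sup>2) \<le> 0"
    by simp
  have ne: "norm (e i) = 1" using ei(2)[OF i(1)] by (simp add: norm_eq_1)
  have ux: "u0 \<le> u x" "u x \<le> A" "u x > 0" using assms(3) assms(4)[OF xX(1)] by auto
  have px: "m \<le> \<phi> x" "\<phi> x > 0" using assms(2) assms(5)[OF xX(1)] by auto
  have sq_le: "(g / w)\<^sup>2 \<le> (G / w0)\<^sup>2" if "\<bar>g\<bar> \<le> G" "w0 \<le> w" "w0 > 0" for g w G w0 :: real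
  proof -
    have "\<bar>g / w\<bar> \<le> G / w0" using that by (auto simp: abs_divide intro!: frac_le)
    then show ?thesis by (metis abs_ge_zero order_trans power2_abs power_mono)
  qed
  have 1: "(sgrad u x (e i) / u x)\<^sup>2 \<le> (A / u0)\<^sup>2"
    using assms(6)[OF xX(1) ei(1)[OF i(1)]] ne ux assms(3) by (intro sq_le) auto
  have 2: "(sgrad \<phi> x (e i) / \<phi> x)\<^sup>2 \<le> (B / m)\<^sup>2"
    using assms(7)[OF xX(1) ei(1)[OF i(1)]] ne px assms(2) by (intro sq_le) auto
  have 3: "- (B / m) \<le> shess \<phi> x (e i) (e i) / \<phi> x"
  proof -
    have "\<bar>shess \<phi> x (e i) (e i)\<bar> \<le> B" using assms(8)[OF xX(1) ei(1)[OF i(1)]] ne by simp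
    then have "\<bar>shess \<phi> x (e i) (e i) / \<phi> x\<bar> \<le> B / m"
      using px assms(2) by (auto simp: abs_divide intro!: frac_le)
    then show ?thesis by linarith
  qed
  define T where "T = (B / m + (B / m)\<^sup>2) / (p - 1)"
  have "(p - 1) * ((M - u x) / u x - (sgrad u x (e i) / u x)\<^sup>2) \<le> B / m + (B / m)\<^sup>2"
    using main 2 3 by linarith
  then have "(M - u x) / u x - (sgrad u x (e i) / u x)\<^sup>2 \<le> T"
    unfolding T_def using assms(1) by (simp add: pos_le_divide_eq mult.commute)
  then have "(M - u x) / u x \<le> (A / u0)\<^sup>2 + T" using 1 by linarith
  then have "M \<le> u x * (1 + (A / u0)\<^sup>2 + T)"
    using ux(3) by (simp add: field_simps)
  also have "\<dots> \<le> A * (1 + (A / u0)\<^sup>2 + T)"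
  proof (intro mult_right_mono ux)
    have "B \<ge> 0" using assms(8)[OF xX(1) ei(1)[OF i(1)]] ne by simp
    then show "0 \<le> 1 + (A / u0)\<^sup>2 + T" using assms(1,2) by (simp add: T_def)
  qed
  finally have "M * (Y \<bullet> Y) \<le> A * (1 + (A / u0)\<^sup>2 + T) * (Y \<bullet> Y)"
    by (intro mult_right_mono) auto
  then show ?thesis using xX(4)[OF assms(9,10)] unfolding T_def M_def by linarith
qed

text \<open>The trace is positive, so \<open>- lam i\<close> is less than the sum of the other
  eigenvalues, hence at most \<open>n * C\<close>. Cauchy-Schwarz in frame coordinates passes from
  eigenvalues to arbitrary pairs of tangent vectors, and \<open>A\<close> accounts for the term
  \<open>u x * (X \<bullet> Y)\<close>.\<close>

lemma hessian_bound:
  assumes "C \<ge> 0" "\<And>y Y. norm y = 1 \<Longrightarrow> Y \<bullet> y = 0 \<Longrightarrow> D2 (hom1 u) y Y Y \<le> C * (Y \<bullet> Y)"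
    and "norm x = 1" "u x \<le> A" "X \<bullet> x = 0" "Y \<bullet> x = 0"
  shows "\<bar>shess u x X Y\<bar> \<le> (real n * C + A) * norm X * norm Y"
proof -
  obtain e lam where "principal_frame x e lam" using principal_frame_exists[OF assms(3)] by blast
  note f = principal_frameD[OF this]
  have lam_le: "lam i \<le> C" if "i < n" for i
    using assms(2)[OF assms(3), of "e i"] f(1) f(2)[OF that that] that by (auto simp: oframe_def)
  have sum: "(\<Sum>i<n. lam i) > 0"
    using P kl by (intro sum_pos_if_in_Gamma[OF _ _ _ f(3)]) auto
  have lam_abs: "\<bar>lam i\<bar> \<le> real n * C" if i: "i < n" for i
  proof -
    have "(\<Sum>i<n. lam i) = lam i + (\<Sum>j\<in>{..<n} - {i}. lam j)"
      using i by (subst sum.remove[of _ i]) auto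
    also have "(\<Sum>j\<in>{..<n} - {i}. lam j) \<le> real (card ({..<n} - {i})) * C"
      using lam_le by (intro sum_bounded_above) auto
    also have "\<dots> \<le> real n * C"
      using assms(1) by (intro mult_right_mono) (auto simp: card_Diff_singleton_if)
    finally have "- lam i \<le> real n * C" using sum by linarith
    moreover have "C \<le> real n * C" using assms(1) n_pos by (simp add: mult_le_cancel_right1)
    ultimately show ?thesis using lam_le[OF i] by linarith
  qed
  have cs: "(\<Sum>i<n. \<bar>X \<bullet> e i\<bar> * \<bar>Y \<bullet> e i\<bar>) \<le> norm X * norm Y"
  proof -
    have nrm: "norm Z = L2_set (\<lambda>i. Z \<bullet> e i) {..<n}" if "Z \<bullet> x = 0" for Z
      using oframe_parseval[OF f(1) dim that, of Z] by (simp add: norm_eq_sqrt_inner L2_set_def power2_eq_square)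
    show ?thesis unfolding nrm[OF assms(5)] nrm[OF assms(6)] by (rule L2_set_mult_ineq)
  qed
  have "\<bar>D2 (hom1 u) x X Y\<bar> \<le> (\<Sum>i<n. \<bar>lam i * ((X \<bullet> e i) * (Y \<bullet> e i))\<bar>)"
    unfolding f(5)[OF assms(5,6)] by (rule sum_abs)
  also have "\<dots> \<le> (\<Sum>i<n. (real n * C) * (\<bar>X \<bullet> e i\<bar> * \<bar>Y \<bullet> e i\<bar>))"
    using lam_abs by (intro sum_mono) (auto simp: abs_mult intro!: mult_right_mono)
  also have "\<dots> \<le> real n * C * (norm X * norm Y)"
    unfolding sum_distrib_left[symmetric] using assms(1) cs by (intro mult_left_mono) auto
  finally have 1: "\<bar>D2 (hom1 u) x X Y\<bar> \<le> real n * C * (norm X * norm Y)" .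
  have 2: "\<bar>u x * (X \<bullet> Y)\<bar> \<le> A * (norm X * norm Y)"
    using u_pos[OF assms(3)] assms(4) Cauchy_Schwarz_ineq2[of X Y]
    by (auto simp: abs_mult intro!: mult_mono)
  have "shess u x X Y = D2 (hom1 u) x X Y - u x * (X \<bullet> Y)"
    using D2_hom1_tangent[OF u_C2 assms(3,5,6)] by simp
  then have "\<bar>shess u x X Y\<bar> \<le> real n * C * (norm X * norm Y) + A * (norm X * norm Y)"
    using 1 2 by linarith
  then show ?thesis by (simp add: algebra_simps)
qed

end

text \<open>\<open>m\<close>, \<open>A\<close> and \<open>B\<close> bound the minimum of
  \<open>\<phi>\<close>, the \<open>C^1\<close> size of \<open>u\<close> and the \<open>C^2\<close>
  size of \<open>\<phi>\<close>. Choosing \<open>C\<close> before \<open>u\<close> and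
  \<open>\<phi>\<close> expresses what it may depend on.\<close>

theorem theorem4p4:
  fixes P k l :: nat and p m A B :: real
  defines "n \<equiv> DIM('a::euclidean_space) - 1"
  assumes "n \<ge> 2" and "1 < P" and "P \<le> n - 1"
    and "l < k" and "k \<le> n choose P"
    and "p > real (k + 1) - real l"
    and "m > 0"
  shows "\<exists>C>0. \<forall>(u::'a \<Rightarrow> real) (\<phi>::'a \<Rightarrow> real).
     ( Ck_sphere 4 u \<and> Ck_sphere 2 \<phi> \<and>
       (\<forall>x\<in>sphere 0 1. u x > 0 \<and> \<phi> x > 0) \<and>
       (\<forall>x\<in>sphere 0 1. \<phi> x \<ge> m) \<and>
       (\<forall>x\<in>sphere 0 1. \<bar>u x\<bar> \<le> A \<and>
          (\<forall>X. X \<bullet> x = 0 \<longrightarrow> \<bar>sgrad u x X\<bar> \<le> A * norm X)) \<and>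
       (\<forall>x\<in>sphere 0 1. \<bar>\<phi> x\<bar> \<le> B \<and>
          (\<forall>X. X \<bullet> x = 0 \<longrightarrow> \<bar>sgrad \<phi> x X\<bar> \<le> B * norm X) \<and>
          (\<forall>X Y. X \<bullet> x = 0 \<longrightarrow> Y \<bullet> x = 0 \<longrightarrow>
                \<bar>shess \<phi> x X Y\<bar> \<le> B * norm X * norm Y)) \<and>
       (\<forall>x\<in>sphere 0 1. \<exists>e lam.
          diag_frame n x (\<lambda>X Y. shess u x X Y + u x * (X \<bullet> Y)) e lam \<and>
          in_Gamma k (multi_idx n P) (Lam lam) \<and>
          sigma k (multi_idx n P) (Lam lam) / sigma l (multi_idx n P) (Lam lam)
            = u x powr (p - 1) * \<phi> x) )
     \<longrightarrow> (\<forall>x\<in>sphere 0 1. \<forall>X Y. X \<bullet> x = 0 \<longrightarrow> Y \<bullet> x = 0 \<longrightarrow>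
            \<bar>shess u x X Y\<bar> \<le> C * norm X * norm Y)"
proof -
  define K where "K = (\<Prod>j\<in>{l..<k}. sigma_quot j (multi_idx n P) (Lam (\<lambda>_. 1)))"
  define u0 where "u0 = (K / (2 ^ (k - l) * B)) powr (1 / (p - 1 - real (k - l)))"
  \<comment> \<open>\<open>M\<close> and \<open>C\<close> are fixed before any solution is given,
    when the signs of \<open>A\<close> and \<open>B\<close> are unknown; the absolute values and the
    summand 1 in \<open>C\<close> ensure positivity regardless.\<close>
  define M where "M = \<bar>A * (1 + (A / u0)\<^sup>2 + (B / m + (B / m)\<^sup>2) / (p - 1))\<bar>"
  define C where "C = real n * M + \<bar>A\<bar> + 1"
  have M: "M \<ge> 0" by (simp add: M_def)
  have "C > 0" using M by (simp add: C_def add_nonneg_pos)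
  moreover have "\<bar>shess u x X Y\<bar> \<le> C * norm X * norm Y"
    if C4: "Ck_sphere 4 u" and C2: "Ck_sphere 2 \<phi>"
      and pos: "\<forall>x\<in>sphere 0 1. u x > 0 \<and> \<phi> x > 0"
      and phi_ge: "\<forall>x\<in>sphere 0 1. \<phi> x \<ge> m"
      and ub: "\<forall>x\<in>sphere 0 1. \<bar>u x\<bar> \<le> A \<and> (\<forall>X. X \<bullet> x = 0 \<longrightarrow> \<bar>sgrad u x X\<bar> \<le> A * norm X)"
      and pb: "\<forall>x\<in>sphere 0 1. \<bar>\<phi> x\<bar> \<le> B \<and>
          (\<forall>X. X \<bullet> x = 0 \<longrightarrow> \<bar>sgrad \<phi> x X\<bar> \<le> B * norm X) \<and>
          (\<forall>X Y. X \<bullet> x = 0 \<longrightarrow> Y \<bullet> x = 0 \<longrightarrow> \<bar>shess \<phi> x X Y\<bar> \<le> B * norm X * norm Y)"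
      and eq: "\<forall>x\<in>sphere 0 1. \<exists>e lam.
          diag_frame n x (\<lambda>X Y. shess u x X Y + u x * (X \<bullet> Y)) e lam \<and>
          in_Gamma k (multi_idx n P) (Lam lam) \<and>
          sigma k (multi_idx n P) (Lam lam) / sigma l (multi_idx n P) (Lam lam) = u x powr (p - 1) * \<phi> x"
      and xXY: "x \<in> sphere 0 1" "X \<bullet> x = 0" "Y \<bullet> x = 0"
    for u \<phi> :: "'a \<Rightarrow> real" and x X Y
  proof -
    have uC2: "Ck_sphere 2 u" using C4 unfolding Ck_sphere_def by (rule Ck_le) simp
    interpret hessian_quotient_solution u \<phi> n P k l p
    proof
      show "DIM('a) = Suc n" using assms(2) by (simp add: n_def)
      fix x :: 'a assume x: "norm x = 1"
      then have "x \<in> sphere 0 1" by simp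
      with eq obtain e lam where "diag_frame n x (\<lambda>X Y. shess u x X Y + u x * (X \<bullet> Y)) e lam"
        "in_Gamma k (multi_idx n P) (Lam lam)"
        "sigma k (multi_idx n P) (Lam lam) / sigma l (multi_idx n P) (Lam lam) = u x powr (p - 1) * \<phi> x"
        by blast
      then show "\<exists>e lam. oframe n x e \<and>
        (\<forall>i<n. \<forall>j<n. D2 (hom1 u) x (e i) (e j) = (if i = j then lam i else 0)) \<and>
        in_Gamma k (multi_idx n P) (Lam lam) \<and>
        sigma k (multi_idx n P) (Lam lam) / sigma l (multi_idx n P) (Lam lam) = u x powr (p - 1) * \<phi> x"
        using diag_frame_hom1[OF uC2 x] by blast
    qed (use assms C4 C2 pos in auto)
    have x: "norm x = 1" using xXY by simp
    have phi_le: "\<phi> y \<le> B" if "norm y = 1" for y using pb that by (auto dest!: bspec[of _ _ y])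
    have u0_le: "u0 \<le> u y" if "norm y = 1" for y
      using u_lower_bound(1)[OF assms(7) phi_le that] by (simp add: u0_def K_def)
    have "K > 0" using u_lower_bound(2)[OF assms(7) phi_le x] by (simp add: K_def)
    moreover have "B > 0" using phi_le[OF x] phi_pos[OF x] by linarith
    ultimately have "u0 > 0" by (simp add: u0_def)
    have upper: "D2 (hom1 u) y Z Z \<le> M * (Z \<bullet> Z)" if y: "norm y = 1" "Z \<bullet> y = 0" for y Z
    proof -
      have "D2 (hom1 u) y Z Z \<le> A * (1 + (A / u0)\<^sup>2 + (B / m + (B / m)\<^sup>2) / (p - 1)) * (Z \<bullet> Z)"
      proof (rule hessian_upper_bound[OF _ assms(8) \<open>u0 > 0\<close> _ _ _ _ _ y])
        show "p > 1" using assms(5,7) by simp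
      qed (use u0_le ub pb phi_ge in \<open>auto simp: abs_le_iff\<close>)
      also have "\<dots> \<le> M * (Z \<bullet> Z)" unfolding M_def by (intro mult_right_mono) auto
      finally show ?thesis .
    qed
    have "u x \<le> \<bar>A\<bar>" using ub xXY(1) by force
    then have "\<bar>shess u x X Y\<bar> \<le> (real n * M + \<bar>A\<bar>) * norm X * norm Y"
      by (intro hessian_bound[OF M upper x _ xXY(2,3)])
    also have "\<dots> \<le> C * norm X * norm Y"
      unfolding C_def by (intro mult_right_mono) auto
    finally show ?thesis .
  qed
  ultimately show ?thesis by blast
qed

end
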